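(* Let $N \ge 1$ be an integer, $k \in [0,1)$, $\mu > 0$, $R>0$, and let $p \in (1, p_E(N,k,\mu)]$, where $$p_E(N,k,\mu) := 1+\frac{2}{(1-k)(N-1)+k+\mu}.$$ Suppose that $f\in H^{1}(\mathbb{R}^N)$ and $g \in L^{2}(\mathbb{R}^N)$ are non-negative functions with compact support in the ball $B(0,R)\subset\mathbb{R}^N$, neither of which vanishes identically. Then there exists $\varepsilon_0=\varepsilon_0(f,g,N,R,p,k,\mu)>0$ such that for every $0<\varepsilon\le\varepsilon_0$ the energy solution $u$ to $$\begin{cases} u_{tt}-t^{-2k}\Delta u+\dfrac{\mu}{t}\, u_t=|u_t|^p, & (x,t)\in \mathbb{R}^N\times[1,\infty),\\ u(x,1)=\varepsilon f(x),\quad u_t(x,1)=\varepsilon g(x), & x\in\mathbb{R}^N,\end{cases}$$ satisfying $$\operatorname{supp}(u) \subset\Big\{(x,t)\in\mathbb{R}^N\times[1,\infty): |x|\le \phi_k(t)+R\Big\},\qquad \phi_k(t):=\frac{t^{1-k}}{1-k},$$ blows up in finite time $T_\varepsilon$ (that is, its lifespan $T_\varepsilon$ is finite), and $$T_\varepsilon \leq \begin{cases} C \, \varepsilon^{-\frac{2(p-1)}{2-((1-k)(N-1)+k+\mu)(p-1)}} & \text{if } 1<p<p_{E}(N,k,\mu),\\[4pt] \exp\left(C\varepsilon^{-(p-1)}\right) & \text{if } p=p_{E}(N,k,\mu),\end{cases}$$ where $C$ is a positive constant independent of $\varepsilon$.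
   Context: Energy solution: for $T>1$, a function $u$ is an energy solution of the Cauchy problem in the claim on $[1,T)$ if $u\in \mathcal{C}([1,T),H^1(\mathbb{R}^N))\cap \mathcal{C}^1([1,T),L^2(\mathbb{R}^N))$, $u_t \in L^p_{\mathrm{loc}}((1,T)\times \mathbb{R}^N)$, $u(x,1)=\varepsilon f(x)$ in $H^1(\mathbb{R}^N)$, and for all $\Phi\in \mathcal{C}_0^{\infty}(\mathbb{R}^N\times[1,T))$ and all $t\in[1,T)$ $$\int_{\mathbb{R}^N}u_t(x,t)\Phi(x,t)\,dx-\varepsilon \int_{\mathbb{R}^N}g(x)\Phi(x,1)\,dx -\int_1^t \int_{\mathbb{R}^N}u_t(x,s)\Phi_t(x,s)\,dx \,ds+\int_1^t s^{-2k} \int_{\mathbb{R}^N}\nabla u(x,s)\cdot\nabla\Phi(x,s)\, dx \,ds$$ $$+\int_1^t \int_{\mathbb{R}^N}\frac{\mu}{s}u_t(x,s) \Phi(x,s)\,dx \,ds=\int_1^t \int_{\mathbb{R}^N}|u_t(x,s)|^p\Phi(x,s)\,dx \,ds.$$ The lifespan $T_\varepsilon$ is the maximal existence time of the energy solution $u$, i.e. the supremum of the $T$ such that $u$ exists as an energy solution on $[1,T)$ (with the stated support property). The constant $C$ may depend on $f,g,N,R,p,k,\mu$. *)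

theory Defs
  imports "HOL-Analysis.Analysis"
begin

section \<open>Smooth compactly supported functions\<close>

primrec Ck :: "nat \<Rightarrow> ('a::euclidean_space \<Rightarrow> real) \<Rightarrow> bool" where
  "Ck 0 h = continuous_on UNIV h"
| "Ck (Suc n) h = ((\<forall>x. h differentiable (at x)) \<and>
      (\<forall>b\<in>Basis. Ck n (\<lambda>x. frechet_derivative h (at x) b)))"

definition test_function :: "'a::euclidean_space set \<Rightarrow> ('a \<Rightarrow> real) \<Rightarrow> bool" where
  "test_function \<Omega> \<phi> \<longleftrightarrow> (\<forall>n. Ck n \<phi>) \<and>
     compact (closure {x. \<phi> x \<noteq> 0}) \<and> closure {x. \<phi> x \<noteq> 0} \<subseteq> \<Omega>"


section \<open>Function spaces\<close>

text \<open>Elements of \<open>L\<^sup>2\<close>, \<open>H\<^sup>1\<close> and \<open>L\<^sup>p\<^sub>l\<^sub>o\<^sub>c\<close> are represented by Borel functions (every Lebesgue class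
  contains one); every notion below depends only on almost-everywhere classes.\<close>

definition L2 :: "('a::euclidean_space \<Rightarrow> 'b::euclidean_space) \<Rightarrow> bool" where
  "L2 h \<longleftrightarrow> h \<in> borel_measurable lborel \<and> integrable lborel (\<lambda>x. (norm (h x))\<^sup>2)"

definition L2_nrm :: "('a::euclidean_space \<Rightarrow> 'b::euclidean_space) \<Rightarrow> real" where
  "L2_nrm h = sqrt (LINT x|lborel. (norm (h x))\<^sup>2)"

definition weak_gradient :: "('a::euclidean_space \<Rightarrow> real) \<Rightarrow> ('a \<Rightarrow> 'a) \<Rightarrow> bool" where
  "weak_gradient h G \<longleftrightarrow> (\<forall>\<phi>. test_function UNIV \<phi> \<longrightarrow> (\<forall>b\<in>Basis.
     (LINT x|lborel. h x * frechet_derivative \<phi> (at x) b) =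
     - (LINT x|lborel. (G x \<bullet> b) * \<phi> x)))"

definition H1 :: "('a::euclidean_space \<Rightarrow> real) \<Rightarrow> bool" where
  "H1 h \<longleftrightarrow> L2 h \<and> (\<exists>G. L2 G \<and> weak_gradient h G)"

text \<open>For \<open>h\<close> in \<open>H\<^sup>1\<close> the weak gradient is unique up to a null set; \<open>wgrad\<close> picks a representative.\<close>

definition wgrad :: "('a::euclidean_space \<Rightarrow> real) \<Rightarrow> 'a \<Rightarrow> 'a" where
  "wgrad h = (SOME G. L2 G \<and> weak_gradient h G)"

definition H1_nrm :: "('a::euclidean_space \<Rightarrow> real) \<Rightarrow> real" where
  "H1_nrm h = sqrt ((L2_nrm h)\<^sup>2 + (L2_nrm (wgrad h))\<^sup>2)"

definition Lp_loc :: "real \<Rightarrow> 'a::euclidean_space set \<Rightarrow> ('a \<Rightarrow> real) \<Rightarrow> bool" where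
  "Lp_loc p \<Omega> h \<longleftrightarrow> set_borel_measurable lborel \<Omega> h \<and>
     (\<forall>K. compact K \<and> K \<subseteq> \<Omega> \<longrightarrow> set_integrable lborel K (\<lambda>z. \<bar>h z\<bar> powr p))"

definition ess_support :: "('a::euclidean_space \<Rightarrow> real) \<Rightarrow> 'a set" where
  "ess_support h = {x. \<forall>U. open U \<and> x \<in> U \<longrightarrow> \<not> (AE y in lborel. y \<in> U \<longrightarrow> h y = 0)}"


section \<open>Curves with values in function spaces\<close>

text \<open>A function \<open>u(x,t)\<close> on \<open>\<real>\<^sup>N \<times> [1,T)\<close> is the curve \<open>t \<mapsto> u t\<close>; values \<open>u t\<close> with \<open>t \<notin> [1,T)\<close> play
  no role. Limits are taken within \<open>[1,T)\<close>, so they are one-sided at \<open>t = 1\<close>.\<close>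

definition C_H1 :: "real \<Rightarrow> (real \<Rightarrow> 'a::euclidean_space \<Rightarrow> real) \<Rightarrow> bool" where
  "C_H1 T u \<longleftrightarrow> (\<forall>t\<in>{1..<T}. H1 (u t) \<and>
     ((\<lambda>s. H1_nrm (\<lambda>x. u s x - u t x)) \<longlongrightarrow> 0) (at t within {1..<T}))"

definition C_L2 :: "real \<Rightarrow> (real \<Rightarrow> 'a::euclidean_space \<Rightarrow> real) \<Rightarrow> bool" where
  "C_L2 T v \<longleftrightarrow> (\<forall>t\<in>{1..<T}. L2 (v t) \<and>
     ((\<lambda>s. L2_nrm (\<lambda>x. v s x - v t x)) \<longlongrightarrow> 0) (at t within {1..<T}))"

definition L2_time_derivative ::
    "real \<Rightarrow> (real \<Rightarrow> 'a::euclidean_space \<Rightarrow> real) \<Rightarrow> (real \<Rightarrow> 'a \<Rightarrow> real) \<Rightarrow> bool" where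
  "L2_time_derivative T u v \<longleftrightarrow> (\<forall>t\<in>{1..<T}. L2 (u t) \<and> L2 (v t) \<and>
     ((\<lambda>s. L2_nrm (\<lambda>x. (u s x - u t x) / (s - t) - v t x)) \<longlongrightarrow> 0) (at t within {1..<T}))"

text \<open>The support of \<open>u\<close> relative to \<open>\<real>\<^sup>N \<times> [1,T)\<close>: the points without a space-time neighbourhood
  on which \<open>u\<close> vanishes.\<close>

definition curve_support :: "real \<Rightarrow> (real \<Rightarrow> 'a::euclidean_space \<Rightarrow> real) \<Rightarrow> ('a \<times> real) set" where
  "curve_support T u = {(x, t). t \<in> {1..<T} \<and>
     (\<forall>U J. open U \<and> x \<in> U \<and> open J \<and> t \<in> J \<longrightarrow>
        (\<exists>s \<in> J \<inter> {1..<T}. \<not> (AE y in lborel. y \<in> U \<longrightarrow> u s y = 0)))}"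


section \<open>Energy solutions and lifespan\<close>

definition dt :: "('a::euclidean_space \<times> real \<Rightarrow> real) \<Rightarrow> 'a \<Rightarrow> real \<Rightarrow> real" where
  "dt \<Phi> x s = frechet_derivative \<Phi> (at (x, s)) (0, 1)"

definition grad_x :: "('a::euclidean_space \<times> real \<Rightarrow> real) \<Rightarrow> 'a \<Rightarrow> real \<Rightarrow> 'a" where
  "grad_x \<Phi> x s = (\<Sum>b\<in>Basis. frechet_derivative \<Phi> (at (x, s)) (b, 0) *\<^sub>R b)"

text \<open>\<open>C\<^sub>0\<^sup>\<infinity>(\<real>\<^sup>N \<times> [1,T))\<close> consists of the restrictions to \<open>t \<ge> 1\<close> of smooth functions with compact
  support in \<open>\<real>\<^sup>N \<times> (-\<infinity>,T)\<close>; they need not vanish at \<open>t = 1\<close>. The identity presupposes that its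
  right-hand side is a convergent integral. As \<open>L\<^sup>p\<^sub>l\<^sub>o\<^sub>c\<close> on the open interval does not give
  this up to \<open>s = 1\<close>, it is stated explicitly; otherwise a divergent integral would silently
  be read as \<open>0\<close>. The other integrals converge by continuity of \<open>u\<close> and \<open>v\<close>.\<close>

definition energy_solution ::
    "real \<Rightarrow> real \<Rightarrow> real \<Rightarrow> ('a::euclidean_space \<Rightarrow> real) \<Rightarrow> ('a \<Rightarrow> real) \<Rightarrow> real \<Rightarrow> real
      \<Rightarrow> (real \<Rightarrow> 'a \<Rightarrow> real) \<Rightarrow> bool" where
  "energy_solution k \<mu> p f g \<epsilon> T u \<longleftrightarrow>
     C_H1 T u \<and> (AE x in lborel. u 1 x = \<epsilon> * f x) \<and>
     (\<exists>v. L2_time_derivative T u v \<and> C_L2 T v \<and>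
        Lp_loc p (UNIV \<times> {1<..<T}) (\<lambda>(x, t). v t x) \<and>
        (\<forall>\<Phi>. test_function (UNIV \<times> {..<T}) \<Phi> \<longrightarrow> (\<forall>t\<in>{1..<T}.
           set_integrable lborel (UNIV \<times> {1..t}) (\<lambda>(x, s). \<bar>v s x\<bar> powr p * \<Phi> (x, s)) \<and>
           (LINT x|lborel. v t x * \<Phi> (x, t))
           - \<epsilon> * (LINT x|lborel. g x * \<Phi> (x, 1))
           - (LINT s:{1..t}|lborel. LINT x|lborel. v s x * dt \<Phi> x s)
           + (LINT s:{1..t}|lborel. s powr (- 2 * k) *
                (LINT x|lborel. wgrad (u s) x \<bullet> grad_x \<Phi> x s))
           + (LINT s:{1..t}|lborel. LINT x|lborel. \<mu> / s * v s x * \<Phi> (x, s))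
           = (LINT s:{1..t}|lborel. LINT x|lborel. \<bar>v s x\<bar> powr p * \<Phi> (x, s)))))"

definition \<phi>k :: "real \<Rightarrow> real \<Rightarrow> real" where
  "\<phi>k k t = t powr (1 - k) / (1 - k)"

text \<open>The maximal existence time; it is \<open>\<infinity>\<close> if solutions exist on \<open>[1,T)\<close> for arbitrarily large
  \<open>T\<close>, and \<open>-\<infinity>\<close> if the data admit no local energy solution.\<close>

definition lifespan ::
    "real \<Rightarrow> real \<Rightarrow> real \<Rightarrow> real \<Rightarrow> ('a::euclidean_space \<Rightarrow> real) \<Rightarrow> ('a \<Rightarrow> real) \<Rightarrow> real \<Rightarrow> ereal" where
  "lifespan k \<mu> R p f g \<epsilon> = Sup {ereal T | T. 1 < T \<and>
     (\<exists>u. energy_solution k \<mu> p f g \<epsilon> T u \<and>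
          curve_support T u \<subseteq> {(x, t). 1 \<le> t \<and> norm x \<le> \<phi>k k t + R})}"

definition p_E :: "nat \<Rightarrow> real \<Rightarrow> real \<Rightarrow> real" where
  "p_E N k \<mu> = 1 + 2 / ((1 - k) * (real N - 1) + k + \<mu>)"

end

theory Submission
  imports Defs
begin

text \<open>Blow-up is detected by one scalar average of the solution. Fix a coordinate direction \<open>e\<close> and
  test the equation with the exponential \<open>\<phi>(x) = exp (x \<bullet> e)\<close>, a positive solution of
  \<open>\<Delta>\<phi> = \<phi>\<close>. The averages \<open>F = \<integral> u \<phi>\<close> and \<open>W = F' = \<integral> u\<^sub>t \<phi>\<close> satisfy
  \<open>W' + (\<mu>/t) W = t\<^sup>-\<^sup>2\<^sup>k F + \<integral> |u\<^sub>t|\<^sup>p \<phi>\<close>, and start from positive multiples of \<open>\<epsilon>\<close>. A single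
  direction suffices where one usually averages \<open>e\<close> over the sphere: the only quantitative property of
  \<open>\<phi>\<close> that enters is its integral over a ball of radius \<open>r\<close>, of size \<open>r\<^sup>(\<^sup>N\<^sup>-\<^sup>1\<^sup>)\<^sup>/\<^sup>2 exp r\<close>
  (\<open>exponential_ball_integral\<close>), and balls are rotation invariant. As \<open>u\<^sub>t\<close> is
  supported in the ball of radius \<open>\<phi>k k t + R\<close>, Jensen's inequality bounds the nonlinear term from
  below by a multiple of
  \<open>t powr (- (1 - k) (N - 1) (p - 1) / 2) * exp (- (p - 1) \<phi>k k t) * |W|\<^sup>p\<close>
  (\<open>energy_solution_averaged\<close>).

  What remains is a scalar problem. By the WKB heuristic, growing solutions of the linear equation have
  \<open>W\<close> of size \<open>t powr (- (k + \<mu>) / 2) * exp (\<phi>k k t)\<close>, so the right unknown is \<open>\<beta> W\<close>, where \<open>\<beta>\<close>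
  (\<open>amp\<close>) is the reciprocal of that growth. Instead of
  solving the linear equation by Bessel functions, \<open>outgoing_wave_lower_bound\<close> uses explicit approximate
  multipliers to show that \<open>\<beta> W\<close> dominates a multiple of
  \<open>A(t) = const \<epsilon> + \<integral>\<^sub>1\<^sup>t \<beta> Q\<close>, where \<open>Q\<close> is the lower bound of the nonlinear term. Inserting this
  into \<open>Q\<close> gives \<open>A' \<ge> const t powr (- \<Lambda>) * A\<^sup>p\<close> with
  \<open>2 \<Lambda> = ((1 - k) (N - 1) + k + \<mu>) (p - 1)\<close>. Separating variables,
  \<open>\<integral>\<^sub>1\<^sup>T t powr (- \<Lambda>) dt \<le> const \<epsilon> powr (1 - p)\<close> (\<open>blow_up_time_bound\<close>). The condition on \<open>p\<close> says
  exactly that \<open>\<Lambda> \<le> 1\<close>, so the integral diverges as \<open>T\<close> grows, like a power of \<open>T\<close> below the critical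
  exponent and like \<open>ln T\<close> at it; these are the two lifespan bounds.\<close>

section \<open>Smooth functions and cut-offs\<close>

lemma Ck_SucI:
  assumes "\<And>x. (h has_derivative h' x) (at x)" and "\<And>b. b \<in> Basis \<Longrightarrow> Ck n (\<lambda>x. h' x b)"
  shows "Ck (Suc n) h"
proof -
  have "frechet_derivative h (at x) = h' x" for x
    using frechet_derivative_at[OF assms(1)] by metis
  then show ?thesis
    using assms by (auto intro: differentiableI)
qed

lemma Ck_Suc_has_derivative:
  "Ck (Suc n) h \<Longrightarrow> (h has_derivative frechet_derivative h (at x)) (at x)"
  by (simp add: frechet_derivative_works)

lemma Ck_Suc_derivative: "Ck (Suc n) h \<Longrightarrow> b \<in> Basis \<Longrightarrow> Ck n (\<lambda>x. frechet_derivative h (at x) b)"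
  by simp

lemma Ck_SucD: "Ck (Suc n) h \<Longrightarrow> Ck n h"
proof (induction n arbitrary: h)
  case 0
  then show ?case
    by (auto intro!: continuous_at_imp_continuous_on differentiable_imp_continuous_within)
next
  case (Suc n)
  show ?case
    by (rule Ck_SucI[OF Ck_Suc_has_derivative[OF Suc.prems]])
      (rule Suc.IH[OF Ck_Suc_derivative[OF Suc.prems]])
qed

lemma Ck_const: "Ck n (\<lambda>x. c)"
  by (induction n arbitrary: c) (auto simp: frechet_derivative_const)

lemma Ck_add:
  assumes "Ck n f" "Ck n g"
  shows "Ck n (\<lambda>x. f x + g x)"
  using assms
proof (induction n arbitrary: f g)
  case 0
  then show ?case by (auto intro: continuous_intros)
next
  case (Suc n)
  show ?case
    by (rule Ck_SucI[OF has_derivative_add[OF Suc.prems[THEN Ck_Suc_has_derivative]]])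
      (intro Suc.IH Suc.prems[THEN Ck_Suc_derivative])
qed

lemma Ck_mult:
  assumes "Ck n f" "Ck n g"
  shows "Ck n (\<lambda>x. f x * g x)"
  using assms
proof (induction n arbitrary: f g)
  case 0
  then show ?case by (auto intro: continuous_intros)
next
  case (Suc n)
  show ?case
    by (rule Ck_SucI[OF has_derivative_mult[OF Suc.prems[THEN Ck_Suc_has_derivative]]])
      (intro Ck_add Suc.IH Suc.prems[THEN Ck_Suc_derivative] Suc.prems[THEN Ck_SucD])
qed

lemma Ck_uminus: "Ck n f \<Longrightarrow> Ck n (\<lambda>x. - f x)"
  using Ck_mult[OF Ck_const[of n "- 1"], of f] by simp

lemma Ck_diff: "Ck n f \<Longrightarrow> Ck n g \<Longrightarrow> Ck n (\<lambda>x. f x - g x)"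
  using Ck_add[OF _ Ck_uminus, of n f g] by simp

lemma Ck_inner_const: "Ck n (\<lambda>x. x \<bullet> c)"
proof (cases n)
  case 0
  then show ?thesis by (auto intro!: continuous_intros)
next
  case (Suc m)
  have "((\<lambda>x. x \<bullet> c) has_derivative (\<lambda>h. h \<bullet> c)) (at x)" for x
    by (auto intro!: derivative_eq_intros)
  then show ?thesis
    unfolding Suc by (rule Ck_SucI) (rule Ck_const)
qed

lemma Ck_inner_self: "Ck n (\<lambda>x. x \<bullet> x)"
proof (cases n)
  case 0
  then show ?thesis by (auto intro!: continuous_intros)
next
  case (Suc m)
  have "((\<lambda>x. x \<bullet> x) has_derivative (\<lambda>h. x \<bullet> h + h \<bullet> x)) (at x)" for x :: 'a
    by (auto intro!: derivative_eq_intros)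
  moreover have "Ck m (\<lambda>x. x \<bullet> b + b \<bullet> x)" for b :: 'a
    using Ck_add[OF Ck_inner_const[of m b] Ck_inner_const[of m b]] by (simp add: inner_commute)
  ultimately show ?thesis
    unfolding Suc by (rule Ck_SucI)
qed

lemma Ck_exp:
  assumes "Ck n f"
  shows "Ck n (\<lambda>x. exp (f x))"
  using assms
proof (induction n)
  case 0
  then show ?case by (auto intro: continuous_intros)
next
  case (Suc n)
  show ?case
    by (rule Ck_SucI[OF has_derivative_exp[OF Ck_Suc_has_derivative[OF Suc.prems]]])
      (intro Ck_mult Suc.IH Ck_SucD[OF Suc.prems] Ck_Suc_derivative[OF Suc.prems])
qed

lemma Ck_inverse:
  assumes "Ck n f" "\<And>x. f x \<noteq> 0"
  shows "Ck n (\<lambda>x. inverse (f x))"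
  using assms(1)
proof (induction n)
  case 0
  then show ?case using assms(2) by (auto intro: continuous_intros)
next
  case (Suc n)
  have "((\<lambda>x. inverse (f x)) has_derivative
      (\<lambda>h. - (inverse (f x) * frechet_derivative f (at x) h * inverse (f x)))) (at x)" for x
    using Deriv.has_derivative_inverse[OF assms(2) Ck_Suc_has_derivative[OF Suc.prems]] by simp
  then show ?case
    by (rule Ck_SucI) (intro Ck_mult Ck_uminus Suc.IH Ck_SucD[OF Suc.prems] Ck_Suc_derivative[OF Suc.prems])
qed

text \<open>Up to factors of \<open>1/t\<close> this is the classical function \<open>exp (- 1/t)\<close>, extended by \<open>0\<close>. The whole
  family is needed because it is closed under differentiation up to linear combinations, so that
  smoothness follows by induction.\<close>

definition flat :: "nat \<Rightarrow> real \<Rightarrow> real" where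
  "flat m t = (if t \<le> 0 then 0 else exp (- inverse t) * inverse t ^ m)"

lemma flat_nonneg: "0 \<le> flat m t"
  by (simp add: flat_def)

lemma power_div_fact_le_exp:
  fixes y :: real
  assumes "0 \<le> y"
  shows "y ^ n / fact n \<le> exp y"
proof -
  have "(\<lambda>k. if k = n then y ^ k / fact k else 0) sums (y ^ n / fact n)"
    by (rule sums_single)
  moreover have "(\<lambda>k. y ^ k / fact k) sums exp y"
    using exp_converges[of y] by (simp add: divide_inverse mult.commute)
  ultimately show ?thesis
    by (rule sums_le[rotated]) (use assms in auto)
qed

text \<open>Quadratic decay at \<open>0\<close> is all that differentiability there requires; it follows from
  \<open>y ^ (m + 2) / fact (m + 2) \<le> exp y\<close> at \<open>y = 1 / t\<close>.\<close>

lemma flat_le_square: "flat m t \<le> fact (m + 2) * t\<^sup>2"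
proof (cases "t \<le> 0")
  case False
  define y where "y = inverse t"
  have y: "0 < y" using False by (simp add: y_def)
  have "y ^ (m + 2) / fact (m + 2) \<le> exp y"
    by (rule power_div_fact_le_exp) (use y in simp)
  then have "y ^ m * y\<^sup>2 \<le> fact (m + 2) * exp y"
    by (simp only: power_add pos_divide_le_eq[OF fact_gt_zero] mult.commute)
  then have "exp (- y) * (y ^ m * y\<^sup>2) \<le> exp (- y) * (fact (m + 2) * exp y)"
    by (intro mult_left_mono) auto
  also have "\<dots> = fact (m + 2) * (exp (- y) * exp y)"
    by (simp only: mult.left_commute)
  also have "exp (- y) * exp y = 1"
    by (simp add: exp_minus)
  finally have "(exp (- y) * y ^ m) * y\<^sup>2 \<le> fact (m + 2)"
    by (simp only: mult.assoc mult_1_right)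
  then have "exp (- y) * y ^ m \<le> fact (m + 2) / y\<^sup>2"
    using y by (simp only: pos_le_divide_eq zero_less_power)
  also have "\<dots> = fact (m + 2) * t\<^sup>2"
    by (simp only: y_def power_inverse divide_inverse inverse_inverse_eq)
  finally show ?thesis
    using False by (simp only: flat_def y_def if_False)
next
  case True
  have "0 \<le> fact (m + 2) * t\<^sup>2"
    by (intro mult_nonneg_nonneg fact_ge_zero zero_le_power2)
  then show ?thesis
    using True by (simp only: flat_def if_True)
qed

lemma flat_has_real_derivative:
  "(flat m has_real_derivative flat (m + 2) t - real m * flat (m + 1) t) (at t)"
proof -
  consider "t < 0" | "t = 0" | "0 < t" by linarith
  then show ?thesis
  proof cases
    case 1
    have "((\<lambda>_. 0) has_real_derivative 0) (at t)" by simp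
    then have "(flat m has_real_derivative 0) (at t)"
      by (rule has_field_derivative_transform_within_open[where S = "{..<0}"]) (use 1 in \<open>auto simp: flat_def\<close>)
    then show ?thesis using 1 by (simp add: flat_def)
  next
    case 3
    have "((\<lambda>t. exp (- inverse t) * inverse t ^ m) has_real_derivative
        exp (- inverse t) * (inverse t)\<^sup>2 * inverse t ^ m
        - exp (- inverse t) * (real m * inverse t ^ (m - 1) * (inverse t)\<^sup>2)) (at t)"
      using 3 by (auto intro!: derivative_eq_intros simp: power2_eq_square)
    moreover have "exp (- inverse t) * (inverse t)\<^sup>2 * inverse t ^ m
        - exp (- inverse t) * (real m * inverse t ^ (m - 1) * (inverse t)\<^sup>2)
        = flat (m + 2) t - real m * flat (m + 1) t"
    proof (cases m)
      case 0
      then show ?thesis using 3 by (simp add: flat_def power2_eq_square)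
    next
      case (Suc j)
      then show ?thesis using 3 by (simp add: flat_def power2_eq_square)
    qed
    ultimately have "((\<lambda>t. exp (- inverse t) * inverse t ^ m) has_real_derivative
        flat (m + 2) t - real m * flat (m + 1) t) (at t)"
      by metis
    then show ?thesis
      by (rule has_field_derivative_transform_within_open[where S = "{0<..}"]) (use 3 in \<open>auto simp: flat_def\<close>)
  next
    case 2
    have "((\<lambda>h. flat m h / h) \<longlongrightarrow> 0) (at 0)"
    proof (rule Lim_null_comparison)
      have "norm (flat m h / h) \<le> fact (m + 2) * \<bar>h\<bar>" for h
      proof (cases "h = 0")
        case False
        have "norm (flat m h / h) = flat m h / \<bar>h\<bar>"
          using flat_nonneg[of m h] by simp
        also have "\<dots> \<le> fact (m + 2) * h\<^sup>2 / \<bar>h\<bar>"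
          by (intro divide_right_mono flat_le_square) simp
        also have "\<dots> = fact (m + 2) * \<bar>h\<bar>"
          using False by (simp add: power2_eq_square abs_if)
        finally show ?thesis .
      qed simp
      then show "\<forall>\<^sub>F h in at 0. norm (flat m h / h) \<le> fact (m + 2) * \<bar>h\<bar>" by simp
      show "((\<lambda>h. fact (m + 2) * \<bar>h\<bar>) \<longlongrightarrow> (0::real)) (at 0)"
        by (auto intro!: tendsto_eq_intros)
    qed
    then show ?thesis using 2 by (simp add: DERIV_def flat_def)
  qed
qed

lemma Ck_flat:
  assumes "Ck n f"
  shows "Ck n (\<lambda>x. flat m (f x))"
  using assms
proof (induction n arbitrary: m)
  case 0
  have "continuous_on UNIV (flat m)"
    using flat_has_real_derivative[of m]
    by (meson DERIV_isCont continuous_at_imp_continuous_on)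
  then have "continuous_on UNIV (flat m \<circ> f)"
    using 0 by (intro continuous_on_compose) (auto intro: continuous_on_subset)
  then show ?case by (simp add: o_def)
next
  case (Suc n)
  have "((\<lambda>x. flat m (f x)) has_derivative
      (\<lambda>h. frechet_derivative f (at x) h * (flat (m + 2) (f x) - real m * flat (m + 1) (f x)))) (at x)" for x
    using has_derivative_compose[OF Ck_Suc_has_derivative[OF Suc.prems, of x]
        flat_has_real_derivative[unfolded has_field_derivative_def, of m]]
    by (simp add: mult.commute[of _ "frechet_derivative f (at x) _"])
  then show ?case
    by (rule Ck_SucI)
      (intro Ck_mult Ck_diff Ck_const Suc.IH Ck_SucD[OF Suc.prems] Ck_Suc_derivative[OF Suc.prems])
qed

text \<open>A smooth transition: the denominator never vanishes, because \<open>y\<close> and \<open>1 - y\<close> are not both nonpositive.\<close>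

definition step :: "real \<Rightarrow> real" where
  "step y = flat 0 y * inverse (flat 0 y + flat 0 (1 - y))"

lemma step_denominator_pos: "0 < flat 0 y + flat 0 (1 - y)"
  by (cases "y \<le> 0") (auto simp: flat_def intro: add_pos_nonneg)

lemma Ck_step: "Ck n f \<Longrightarrow> Ck n (\<lambda>x. step (f x))"
  unfolding step_def
  by (intro Ck_mult Ck_inverse Ck_add Ck_flat Ck_diff Ck_const)
    (simp_all add: step_denominator_pos less_imp_neq[THEN not_sym])

lemma step_eq_1: "1 \<le> y \<Longrightarrow> step y = 1"
  by (simp add: step_def flat_def)

lemma step_eq_0: "y \<le> 0 \<Longrightarrow> step y = 0"
  by (simp add: step_def flat_def)

lemma step_nonneg: "0 \<le> step y"
  using step_denominator_pos[of y] by (simp add: step_def flat_nonneg)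

text \<open>A function of the space variable or of the time variable alone is smooth in space-time, because the
  basis of a product consists of vectors with one vanishing component.\<close>

lemma Ck_fst:
  fixes h :: "'a::euclidean_space \<Rightarrow> real"
  assumes "Ck n h"
  shows "Ck n (\<lambda>z::'a \<times> real. h (fst z))"
  using assms
proof (induction n arbitrary: h)
  case 0
  then show ?case by (auto intro!: continuous_on_compose2[of UNIV h] continuous_intros)
next
  case (Suc n)
  have "((\<lambda>z::'a \<times> real. h (fst z)) has_derivative
      (\<lambda>d. frechet_derivative h (at (fst z)) (fst d))) (at z)" for z
    by (rule has_derivative_compose[OF has_derivative_fst[OF has_derivative_ident]
        Ck_Suc_has_derivative[OF Suc.prems], of z, unfolded id_def])
  then show ?case
  proof (rule Ck_SucI)
    fix b :: "'a \<times> real"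
    assume "b \<in> Basis"
    then consider "fst b \<in> Basis" | "fst b = 0" by (auto simp: Basis_prod_def)
    then show "Ck n (\<lambda>z::'a \<times> real. frechet_derivative h (at (fst z)) (fst b))"
    proof cases
      case 1
      show ?thesis
        using Suc.IH[of "\<lambda>y. frechet_derivative h (at y) (fst b)", OF Ck_Suc_derivative[OF Suc.prems 1]] by blast
    next
      case 2
      then show ?thesis
        using linear_0[OF has_derivative_linear[OF Ck_Suc_has_derivative[OF Suc.prems]]]
        by (simp add: Ck_const)
    qed
  qed
qed

lemma Ck_snd:
  fixes h :: "real \<Rightarrow> real"
  assumes "Ck n h"
  shows "Ck n (\<lambda>z::'a::euclidean_space \<times> real. h (snd z))"
  using assms
proof (induction n arbitrary: h)
  case 0
  then show ?case by (auto intro!: continuous_on_compose2[of UNIV h] continuous_intros)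
next
  case (Suc n)
  have "((\<lambda>z::'a \<times> real. h (snd z)) has_derivative
      (\<lambda>d. frechet_derivative h (at (snd z)) (snd d))) (at z)" for z
    by (rule has_derivative_compose[OF has_derivative_snd[OF has_derivative_ident]
        Ck_Suc_has_derivative[OF Suc.prems], of z, unfolded id_def])
  then show ?case
  proof (rule Ck_SucI)
    fix b :: "'a \<times> real"
    assume "b \<in> Basis"
    then consider "snd b \<in> Basis" | "snd b = 0" by (auto simp: Basis_prod_def)
    then show "Ck n (\<lambda>z::'a \<times> real. frechet_derivative h (at (snd z)) (snd b))"
    proof cases
      case 1
      show ?thesis
        using Suc.IH[of "\<lambda>y. frechet_derivative h (at y) (snd b)", OF Ck_Suc_derivative[OF Suc.prems 1]] by blast
    next
      case 2
      then show ?thesis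
        using linear_0[OF has_derivative_linear[OF Ck_Suc_has_derivative[OF Suc.prems]]]
        by (simp add: Ck_const)
    qed
  qed
qed

lemma test_function_derivative:
  assumes "test_function UNIV h" "b \<in> Basis"
  shows "test_function UNIV (\<lambda>x. frechet_derivative h (at x) b)"
proof -
  have C: "Ck n h" for n using assms by (simp add: test_function_def)
  have "frechet_derivative h (at x) b = 0" if "x \<notin> closure {x. h x \<noteq> 0}" for x
  proof -
    have "((\<lambda>_. 0) has_derivative (\<lambda>_. 0)) (at x)" by simp
    then have "(h has_derivative (\<lambda>_. 0)) (at x)"
      by (rule has_derivative_transform_within_open[where s = "- closure {x. h x \<noteq> 0}"])
        (use that closure_subset[of "{x. h x \<noteq> 0}"] in auto)
    then show ?thesis by (metis frechet_derivative_at)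
  qed
  then have "closure {x. frechet_derivative h (at x) b \<noteq> 0} \<subseteq> closure {x. h x \<noteq> 0}"
    by (intro closure_minimal) auto
  moreover have "Ck n (\<lambda>x. frechet_derivative h (at x) b)" for n
    using Ck_Suc_derivative[OF C assms(2)] .
  moreover have "compact (closure {x. h x \<noteq> 0} \<inter> closure {x. frechet_derivative h (at x) b \<noteq> 0})"
    using assms(1) by (intro compact_Int_closed) (auto simp: test_function_def)
  ultimately show ?thesis
    unfolding test_function_def
    by (simp add: inf.absorb2)
qed

lemma test_functionI:
  assumes "\<And>n. Ck n h" "compact K" "K \<subseteq> \<Omega>" "\<And>x. x \<notin> K \<Longrightarrow> h x = 0"
  shows "test_function \<Omega> h"
proof -
  have sub: "closure {x. h x \<noteq> 0} \<subseteq> K"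
    using assms(2,4) by (intro closure_minimal compact_imp_closed) auto
  then have "compact (K \<inter> closure {x. h x \<noteq> 0})"
    using assms(2) by (intro compact_Int_closed) auto
  then show ?thesis
    using sub assms by (auto simp: test_function_def inf.absorb2)
qed

lemma test_function_has_derivative:
  "test_function \<Omega> h \<Longrightarrow> (h has_derivative frechet_derivative h (at x)) (at x)"
  by (rule Ck_Suc_has_derivative[of 0]) (simp only: test_function_def)

text \<open>The exponential is not compactly supported. By finite speed of propagation only its values on a
  large ball matter, so it is cut off outside; on the ball it is still an eigenfunction of the Laplacian,
  here written as the sum of the iterated derivatives in the basis directions.\<close>

lemma truncated_exponential:
  fixes e :: "'a::euclidean_space"
  assumes e: "e \<in> Basis" and r: "0 < r"
  obtains \<psi> where "test_function UNIV \<psi>" and "\<And>x. 0 \<le> \<psi> x"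
    and "\<And>x. norm x \<le> r \<Longrightarrow> \<psi> x = exp (x \<bullet> e)"
    and "\<And>x. norm x < r \<Longrightarrow>
      (\<Sum>b\<in>Basis. frechet_derivative (\<lambda>y. frechet_derivative \<psi> (at y) b) (at x) b) = \<psi> x"
proof
  define \<psi> :: "'a \<Rightarrow> real" where "\<psi> x = step (r\<^sup>2 + 1 - x \<bullet> x) * exp (x \<bullet> e)" for x
  show eq: "\<psi> x = exp (x \<bullet> e)" if "norm x \<le> r" for x
  proof -
    have "x \<bullet> x \<le> r\<^sup>2"
      using power_mono[OF that norm_ge_zero, of 2] by (simp add: dot_square_norm)
    then show ?thesis by (simp add: \<psi>_def step_eq_1)
  qed
  show "0 \<le> \<psi> x" for x by (simp add: \<psi>_def step_nonneg)
  show "test_function UNIV \<psi>"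
  proof (rule test_functionI)
    show "Ck n \<psi>" for n
      unfolding \<psi>_def[abs_def]
      by (intro Ck_mult Ck_step Ck_exp Ck_inner_const Ck_diff Ck_const Ck_inner_self)
    show "\<psi> x = 0" if "x \<notin> cball 0 (r + 1)" for x
    proof -
      have "(r + 1)\<^sup>2 \<le> x \<bullet> x"
        using power_mono[of "r + 1" "norm x" 2] that r by (simp add: dot_square_norm)
      then have "r\<^sup>2 + 1 - x \<bullet> x \<le> 0"
        using r by (simp add: power2_eq_square algebra_simps)
      then show ?thesis by (simp add: \<psi>_def step_eq_0)
    qed
  qed auto
  have D: "frechet_derivative \<psi> (at y) b = exp (y \<bullet> e) * (b \<bullet> e)" if "norm y < r" for y b
  proof -
    have "((\<lambda>y. exp (y \<bullet> e)) has_derivative (\<lambda>b. exp (y \<bullet> e) * (b \<bullet> e))) (at y)"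
      by (auto intro!: derivative_eq_intros)
    then have "(\<psi> has_derivative (\<lambda>b. exp (y \<bullet> e) * (b \<bullet> e))) (at y)"
      by (rule has_derivative_transform_within_open[where s = "ball 0 r"]) (use that eq in auto)
    from frechet_derivative_at[OF this] show ?thesis by metis
  qed
  have DD: "frechet_derivative (\<lambda>y. frechet_derivative \<psi> (at y) b) (at x) b = exp (x \<bullet> e) * (b \<bullet> e)\<^sup>2"
    if "norm x < r" for x b
  proof -
    have "((\<lambda>y. exp (y \<bullet> e) * (b \<bullet> e)) has_derivative (\<lambda>d. exp (x \<bullet> e) * (d \<bullet> e) * (b \<bullet> e))) (at x)"
      by (auto intro!: derivative_eq_intros)
    then have "((\<lambda>y. frechet_derivative \<psi> (at y) b) has_derivative
        (\<lambda>d. exp (x \<bullet> e) * (d \<bullet> e) * (b \<bullet> e))) (at x)"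
      by (rule has_derivative_transform_within_open[where s = "ball 0 r"]) (use that D in auto)
    from frechet_derivative_at[OF this] show ?thesis
      by (metis mult.assoc power2_eq_square)
  qed
  show "(\<Sum>b\<in>Basis. frechet_derivative (\<lambda>y. frechet_derivative \<psi> (at y) b) (at x) b) = \<psi> x"
    if "norm x < r" for x
  proof -
    have "(\<Sum>b\<in>Basis. exp (x \<bullet> e) * (b \<bullet> e)\<^sup>2) = (\<Sum>b\<in>Basis. if b = e then exp (x \<bullet> e) else 0)"
      using e by (intro sum.cong) (auto simp: inner_Basis)
    then show ?thesis using that e eq[of x] by (simp add: DD)
  qed
qed

text \<open>Turns a spatial test function into an admissible space-time one that does not depend on time on
  \<open>[1, T\<^sub>1]\<close>. The gap between \<open>T\<^sub>1\<close> and \<open>T\<close> leaves room for the cut-off.\<close>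

lemma time_cutoff_test_function:
  fixes \<psi> :: "'a::euclidean_space \<Rightarrow> real"
  assumes \<psi>: "test_function UNIV \<psi>" and T: "1 \<le> T\<^sub>1" "T\<^sub>1 < T"
  obtains \<Phi> where "test_function (UNIV \<times> {..<T}) \<Phi>"
    and "\<And>x s. s \<in> {1..T\<^sub>1} \<Longrightarrow> \<Phi> (x, s) = \<psi> x"
    and "\<And>x s. s \<in> {1..T\<^sub>1} \<Longrightarrow> dt \<Phi> x s = 0"
    and "\<And>x s. s \<in> {1..T\<^sub>1} \<Longrightarrow> grad_x \<Phi> x s = (\<Sum>b\<in>Basis. frechet_derivative \<psi> (at x) b *\<^sub>R b)"
proof
  define d where "d = (T - T\<^sub>1) / 3"
  have d: "0 < d" and dT: "T\<^sub>1 + 2 * d < T" using T by (simp_all add: d_def field_simps)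
  define h where "h s = step ((T\<^sub>1 + 2 * d - s) * (1 / d)) * step (s + 1)" for s
  define \<Phi> where "\<Phi> z = \<psi> (fst z) * h (snd z)" for z :: "'a \<times> real"
  have h1: "h s = 1" if "0 < s" "s < T\<^sub>1 + d" for s
  proof -
    have "1 \<le> (T\<^sub>1 + 2 * d - s) * (1 / d)" using that d by (simp add: field_simps)
    then show ?thesis using that by (simp add: h_def step_eq_1)
  qed
  have h0: "h s = 0" if "s \<notin> {-1..T\<^sub>1 + 2 * d}" for s
  proof (cases "s < -1")
    case True
    then show ?thesis by (simp add: h_def step_eq_0)
  next
    case False
    then have "(T\<^sub>1 + 2 * d - s) * (1 / d) \<le> 0"
      using that d by (simp add: mult_nonpos_nonneg divide_nonpos_pos)
    then show ?thesis by (simp add: h_def step_eq_0)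
  qed
  show "test_function (UNIV \<times> {..<T}) \<Phi>"
  proof (rule test_functionI)
    show "Ck n \<Phi>" for n
    proof -
      have "Ck n (\<lambda>s::real. s)" using Ck_inner_const[of n "1::real"] by simp
      then have "Ck n h"
        unfolding h_def[abs_def] by (intro Ck_mult Ck_step Ck_diff Ck_add Ck_const)
      then show ?thesis
        unfolding \<Phi>_def[abs_def]
        using \<psi> by (intro Ck_mult Ck_fst Ck_snd) (auto simp: test_function_def)
    qed
    show "compact (closure {x. \<psi> x \<noteq> 0} \<times> {-1..T\<^sub>1 + 2 * d})"
      using \<psi> by (intro compact_Times) (auto simp: test_function_def)
    show "closure {x. \<psi> x \<noteq> 0} \<times> {-1..T\<^sub>1 + 2 * d} \<subseteq> UNIV \<times> {..<T}"
      using dT by auto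
    show "\<Phi> z = 0" if "z \<notin> closure {x. \<psi> x \<noteq> 0} \<times> {-1..T\<^sub>1 + 2 * d}" for z
      using that h0 closure_subset[of "{x. \<psi> x \<noteq> 0}"] by (cases z) (auto simp: \<Phi>_def)
  qed
  show "\<Phi> (x, s) = \<psi> x" if "s \<in> {1..T\<^sub>1}" for x s
    using h1[of s] that d by (simp add: \<Phi>_def)
  have D: "frechet_derivative \<Phi> (at (x, s)) = (\<lambda>c. frechet_derivative \<psi> (at x) (fst c))"
    if "s \<in> {1..T\<^sub>1}" for x s
  proof -
    have "((\<lambda>z::'a \<times> real. \<psi> (fst z)) has_derivative
        (\<lambda>c. frechet_derivative \<psi> (at (fst (x, s))) (fst c))) (at (x, s))"
      by (rule has_derivative_compose[OF has_derivative_fst[OF has_derivative_ident]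
          test_function_has_derivative[OF \<psi>], unfolded id_def])
    then have "(\<Phi> has_derivative (\<lambda>c. frechet_derivative \<psi> (at (fst (x, s))) (fst c))) (at (x, s))"
      by (rule has_derivative_transform_within_open[where s = "UNIV \<times> {0<..<T\<^sub>1 + d}"])
        (use that d h1 in \<open>auto simp: \<Phi>_def intro!: open_Times\<close>)
    then show ?thesis using frechet_derivative_at by fastforce
  qed
  show "dt \<Phi> x s = 0" if "s \<in> {1..T\<^sub>1}" for x s
    using linear_0[OF has_derivative_linear[OF test_function_has_derivative[OF \<psi>]]]
    by (simp add: dt_def D[OF that])
  show "grad_x \<Phi> x s = (\<Sum>b\<in>Basis. frechet_derivative \<psi> (at x) b *\<^sub>R b)" if "s \<in> {1..T\<^sub>1}" for x s
    by (simp add: grad_x_def D[OF that])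
qed

section \<open>Square-integrable functions and curves\<close>

lemma L2_measurable [measurable_dest]: "L2 h \<Longrightarrow> h \<in> borel_measurable lborel"
  by (simp add: L2_def)

lemma L2_integrable_square:
  fixes h :: "'a::euclidean_space \<Rightarrow> real"
  shows "L2 h \<Longrightarrow> integrable lborel (\<lambda>x. (h x)\<^sup>2)"
  by (simp add: L2_def)

lemma L2_I:
  fixes h :: "'a::euclidean_space \<Rightarrow> real"
  assumes "h \<in> borel_measurable lborel" "integrable lborel q" "\<And>x. (h x)\<^sup>2 \<le> q x"
  shows "L2 h"
  unfolding L2_def real_norm_def power2_abs
proof
  show "integrable lborel (\<lambda>x. (h x)\<^sup>2)"
    by (rule Bochner_Integration.integrable_bound[OF assms(2)])
      (use assms in \<open>auto intro: order_trans[OF assms(3) abs_ge_self]\<close>)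
qed (rule assms(1))

lemma L2_cmult:
  fixes h :: "'a::euclidean_space \<Rightarrow> real"
  assumes "L2 h"
  shows "L2 (\<lambda>x. c * h x)"
proof (rule L2_I)
  show "(\<lambda>x. c * h x) \<in> borel_measurable lborel" using assms by measurable
  show "integrable lborel (\<lambda>x. c\<^sup>2 * (h x)\<^sup>2)"
    by (intro integrable_mult_right L2_integrable_square assms)
qed (simp add: power_mult_distrib)

lemma L2_diff:
  fixes h w :: "'a::euclidean_space \<Rightarrow> real"
  assumes "L2 h" "L2 w"
  shows "L2 (\<lambda>x. h x - w x)"
proof (rule L2_I)
  show "(\<lambda>x. h x - w x) \<in> borel_measurable lborel" using assms by measurable
  show "integrable lborel (\<lambda>x. 2 * (h x)\<^sup>2 + 2 * (w x)\<^sup>2)"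
    using assms[THEN L2_integrable_square] by auto
  show "(h x - w x)\<^sup>2 \<le> 2 * (h x)\<^sup>2 + 2 * (w x)\<^sup>2" for x
    using zero_le_power2[of "h x + w x"] by (simp add: power2_eq_square algebra_simps)
qed

lemma L2_component:
  fixes G :: "'a::euclidean_space \<Rightarrow> 'a"
  assumes "L2 G" "b \<in> Basis"
  shows "L2 (\<lambda>x. G x \<bullet> b)"
proof (rule L2_I)
  show "(\<lambda>x. G x \<bullet> b) \<in> borel_measurable lborel" using assms(1) by measurable
  show "integrable lborel (\<lambda>x. (norm (G x))\<^sup>2)" using assms(1) by (simp add: L2_def)
  show "(G x \<bullet> b)\<^sup>2 \<le> (norm (G x))\<^sup>2" for x
    using power_mono[OF Basis_le_norm[OF assms(2), of "G x"], of 2] by simp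
qed

lemma L2_mult_integrable:
  fixes h w :: "'a::euclidean_space \<Rightarrow> real"
  assumes "L2 h" "L2 w"
  shows "integrable lborel (\<lambda>x. h x * w x)"
proof (rule Bochner_Integration.integrable_bound)
  show "integrable lborel (\<lambda>x. (h x)\<^sup>2 + (w x)\<^sup>2)"
    using assms[THEN L2_integrable_square] by auto
  show "(\<lambda>x. h x * w x) \<in> borel_measurable lborel" using assms by measurable
  have "\<bar>h x * w x\<bar> \<le> (h x)\<^sup>2 + (w x)\<^sup>2" for x
    using sum_squares_ge_zero[of "h x" "w x"] zero_le_power2[of "h x + w x"] zero_le_power2[of "h x - w x"]
    by (simp add: power2_eq_square algebra_simps abs_le_iff)
  then show "AE x in lborel. norm (h x * w x) \<le> norm ((h x)\<^sup>2 + (w x)\<^sup>2)" by simp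
qed

text \<open>Positivity of the quadratic form \<open>\<integral> (s h - t w)\<^sup>2\<close> in \<open>(s, t)\<close>.\<close>

lemma L2_Cauchy_Schwarz:
  fixes h w :: "'a::euclidean_space \<Rightarrow> real"
  assumes "L2 h" "L2 w"
  shows "\<bar>LINT x|lborel. h x * w x\<bar> \<le> L2_nrm h * L2_nrm w"
proof -
  define a where "a = (LINT x|lborel. (h x)\<^sup>2)"
  define b where "b = (LINT x|lborel. h x * w x)"
  define c where "c = (LINT x|lborel. (w x)\<^sup>2)"
  note int = assms[THEN L2_integrable_square] L2_mult_integrable[OF assms]
  have a0: "0 \<le> a" and c0: "0 \<le> c" by (simp_all add: a_def c_def)
  have quad: "0 \<le> s\<^sup>2 * a - 2 * s * t * b + t\<^sup>2 * c" for s t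
  proof -
    have "0 \<le> (LINT x|lborel. (s * h x - t * w x)\<^sup>2)" by simp
    also have "\<dots> = (LINT x|lborel. (s\<^sup>2 * (h x)\<^sup>2 - 2 * s * t * (h x * w x)) + t\<^sup>2 * (w x)\<^sup>2)"
      by (simp add: power2_eq_square algebra_simps)
    also have "\<dots> = s\<^sup>2 * a - 2 * s * t * b + t\<^sup>2 * c"
      using int by (simp add: a_def b_def c_def)
    finally show ?thesis .
  qed
  have "b\<^sup>2 \<le> a * c"
  proof (cases "c = 0")
    case True
    (* without the term in t\<^sup>2 the form is affine in t; this t turns it into minus the square of b *)
    have "0 \<le> b\<^sup>2 * a - 2 * b * ((a + 1) / 2) * b"
      using quad[of b "(a + 1) / 2"] True by simp
    then have "b\<^sup>2 \<le> 0" by (simp add: power2_eq_square algebra_simps)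
    then show ?thesis using True by simp
  next
    case False
    have "0 \<le> c * (a * c - b\<^sup>2)"
      using quad[of c b] by (simp add: power2_eq_square algebra_simps)
    then show ?thesis using False c0 by (simp add: zero_le_mult_iff)
  qed
  then have "sqrt (b\<^sup>2) \<le> sqrt (a * c)" by (rule real_sqrt_le_mono)
  then show ?thesis
    by (simp add: L2_nrm_def a_def b_def c_def real_sqrt_mult)
qed

lemma test_function_L2:
  assumes "test_function \<Omega> h"
  shows "L2 h"
proof -
  define K where "K = closure {x. h x \<noteq> 0}"
  have K: "compact K" using assms by (simp add: test_function_def K_def)
  have "Ck 0 h" using assms by (simp only: test_function_def)
  then have cont: "continuous_on UNIV h" by simp
  have "integrable lborel (\<lambda>x. indicator K x *\<^sub>R (h x)\<^sup>2)"
    by (intro borel_integrable_compact[OF K] continuous_on_power continuous_on_subset[OF cont]) auto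
  moreover have "(\<lambda>x. indicator K x *\<^sub>R (h x)\<^sup>2) = (\<lambda>x. (h x)\<^sup>2)"
  proof
    show "indicator K x *\<^sub>R (h x)\<^sup>2 = (h x)\<^sup>2" for x
      using closure_subset[of "{x. h x \<noteq> 0}"] by (cases "x \<in> K") (auto simp: K_def)
  qed
  ultimately show ?thesis
    using borel_measurable_continuous_onI[OF cont] by (simp add: L2_def)
qed

text \<open>By the Lindelof property, countably many of the neighbourhoods suffice, and countable unions of null
  sets are null.\<close>

lemma AE_of_local:
  fixes S :: "'a::euclidean_space set"
  assumes "\<And>x. x \<in> S \<Longrightarrow> \<exists>U. open U \<and> x \<in> U \<and> (AE y in lborel. y \<in> U \<longrightarrow> P y)"
  shows "AE y in lborel. y \<in> S \<longrightarrow> P y"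
proof -
  define \<U> where "\<U> = {U. open U \<and> (AE y in lborel. y \<in> U \<longrightarrow> P y)}"
  obtain \<V> where \<V>: "\<V> \<subseteq> \<U>" "countable \<V>" "\<Union>\<V> = \<Union>\<U>"
    using Lindelof[of \<U>] by (auto simp: \<U>_def)
  have "AE y in lborel. \<forall>U\<in>\<V>. y \<in> U \<longrightarrow> P y"
    using \<V> by (subst AE_ball_countable) (auto simp: \<U>_def)
  moreover have "S \<subseteq> \<Union>\<V>" unfolding \<V>(3) \<U>_def using assms by blast
  ultimately show ?thesis by (auto elim!: eventually_mono)
qed

lemma ess_support_AE:
  assumes "ess_support h \<subseteq> S"
  shows "AE x in lborel. x \<notin> S \<longrightarrow> h x = 0"
proof -
  have "AE x in lborel. x \<in> - S \<longrightarrow> h x = 0"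
  proof (rule AE_of_local)
    fix x assume "x \<in> - S"
    then have "x \<notin> ess_support h" using assms by blast
    then show "\<exists>U. open U \<and> x \<in> U \<and> (AE y in lborel. y \<in> U \<longrightarrow> h y = 0)"
      unfolding ess_support_def by simp
  qed
  then show ?thesis by simp
qed

text \<open>On \<open>U\<close> the difference quotients of \<open>u\<close> at \<open>t\<close> vanish, so the \<open>L\<^sup>2\<close> norm of \<open>v t\<close> over \<open>U\<close> is at
  most the \<open>L\<^sup>2\<close> distance of the quotients from \<open>v t\<close>, which tends to \<open>0\<close>.\<close>

lemma time_derivative_local_zero:
  fixes u v :: "real \<Rightarrow> 'a::euclidean_space \<Rightarrow> real"
  assumes d: "L2_time_derivative T u v" and t: "t \<in> {1..<T}"
    and U: "open U" and J: "open J" "t \<in> J"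
    and zero: "\<And>s. s \<in> J \<inter> {1..<T} \<Longrightarrow> AE y in lborel. y \<in> U \<longrightarrow> u s y = 0"
  shows "AE y in lborel. y \<in> U \<longrightarrow> v t y = 0"
proof -
  have L: "L2 (u s)" "L2 (v s)" if "s \<in> {1..<T}" for s
    using d that by (auto simp: L2_time_derivative_def)
  define D where "D s x = (u s x - u t x) / (s - t) - v t x" for s x
  have lim: "((\<lambda>s. (L2_nrm (D s))\<^sup>2) \<longlongrightarrow> 0\<^sup>2) (at t within {1..<T})"
    using d t unfolding L2_time_derivative_def D_def by (intro tendsto_power) auto
  define I where "I = (LINT x|lborel. indicator U x * (v t x)\<^sup>2)"
  have intI: "integrable lborel (\<lambda>x. indicator U x * (v t x)\<^sup>2)"
    using integrable_mult_indicator[of U lborel "\<lambda>x. (v t x)\<^sup>2"] L2_integrable_square[OF L(2)[OF t]] U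
    by simp
  have "I \<le> (L2_nrm (D s))\<^sup>2" if s: "s \<in> J" "s \<in> {1..<T}" for s
  proof -
    have "L2 (D s)"
      using L2_diff[OF L2_cmult[OF L2_diff[OF L(1)[OF s(2)] L(1)[OF t]], of "1 / (s - t)"] L(2)[OF t]]
      by (simp add: D_def[abs_def])
    then have int: "integrable lborel (\<lambda>x. (D s x)\<^sup>2)" by (rule L2_integrable_square)
    have "AE x in lborel. indicator U x * (v t x)\<^sup>2 \<le> (D s x)\<^sup>2"
      using zero[OF IntI[OF s]] zero[OF IntI[OF J(2) t]]
      by eventually_elim (auto simp: D_def indicator_def)
    then have "I \<le> (LINT x|lborel. (D s x)\<^sup>2)"
      unfolding I_def by (intro integral_mono_AE intI int)
    then show ?thesis by (simp add: L2_nrm_def)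
  qed
  then have "\<forall>\<^sub>F s in at t within {1..<T}. I \<le> (L2_nrm (D s))\<^sup>2"
    using J by (auto simp: eventually_at_topological)
  moreover have "t islimpt {1..<T}"
    by (rule islimpt_subset[OF islimpt_greaterThanLessThan1[of t T]]) (use t in auto)
  then have "at t within {1..<T} \<noteq> bot"
    by (simp add: trivial_limit_within)
  ultimately have "I \<le> 0" using tendsto_lowerbound[OF lim] by simp
  moreover have "0 \<le> I" unfolding I_def by (intro Bochner_Integration.integral_nonneg) auto
  ultimately have "I = 0" by (rule antisym)
  then have "AE x in lborel. indicator U x * (v t x)\<^sup>2 = 0"
    using integral_nonneg_eq_0_iff_AE[OF intI] unfolding I_def by simp
  then show ?thesis by (auto elim!: eventually_mono simp: indicator_def)
qed

lemma support_AE: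
  fixes u v :: "real \<Rightarrow> 'a::euclidean_space \<Rightarrow> real"
  assumes d: "L2_time_derivative T u v" and t: "t \<in> {1..<T}"
    and supp: "curve_support T u \<subseteq> {(x, t). 1 \<le> t \<and> norm x \<le> \<rho> t}"
  shows "AE x in lborel. \<rho> t < norm x \<longrightarrow> u t x = 0 \<and> v t x = 0"
proof -
  have "AE x in lborel. x \<in> {x. \<rho> t < norm x} \<longrightarrow> u t x = 0 \<and> v t x = 0"
  proof (rule AE_of_local)
    fix x :: 'a assume "x \<in> {x. \<rho> t < norm x}"
    then have "(x, t) \<notin> curve_support T u" using supp by auto
    then obtain U J where UJ: "open U" "x \<in> U" "open J" "t \<in> J"
      and z: "\<And>s. s \<in> J \<inter> {1..<T} \<Longrightarrow> AE y in lborel. y \<in> U \<longrightarrow> u s y = 0"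
      using t by (auto simp: curve_support_def)
    have "AE y in lborel. y \<in> U \<longrightarrow> u t y = 0" using z UJ t by auto
    moreover have "AE y in lborel. y \<in> U \<longrightarrow> v t y = 0"
      by (rule time_derivative_local_zero[OF d t UJ(1,3,4) z])
    ultimately have "AE y in lborel. y \<in> U \<longrightarrow> u t y = 0 \<and> v t y = 0"
      by eventually_elim simp
    then show "\<exists>U. open U \<and> x \<in> U \<and> (AE y in lborel. y \<in> U \<longrightarrow> u t y = 0 \<and> v t y = 0)"
      using UJ by blast
  qed
  then show ?thesis by simp
qed

text \<open>Norm convergence of the difference quotients implies weak convergence, by Cauchy-Schwarz; the same
  argument gives the continuity statement that follows.\<close>

lemma pairing_has_derivative:
  fixes u v :: "real \<Rightarrow> 'a::euclidean_space \<Rightarrow> real"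
  assumes d: "L2_time_derivative T u v" and t: "t \<in> {1..<T}" and \<psi>: "L2 \<psi>"
  shows "((\<lambda>t. LINT x|lborel. u t x * \<psi> x) has_real_derivative (LINT x|lborel. v t x * \<psi> x))
    (at t within {1..<T})"
proof -
  have L: "L2 (u s)" "L2 (v s)" if "s \<in> {1..<T}" for s
    using d that by (auto simp: L2_time_derivative_def)
  define D where "D s x = (u s x - u t x) / (s - t) - v t x" for s x
  define F where "F t = (LINT x|lborel. u t x * \<psi> x)" for t
  define V where "V = (LINT x|lborel. v t x * \<psi> x)"
  have bound: "norm ((F s - F t) / (s - t) - V) \<le> L2_nrm (D s) * L2_nrm \<psi>" if s: "s \<in> {1..<T}" for s
  proof -
    have LD: "L2 (D s)"
      using L2_diff[OF L2_cmult[OF L2_diff[OF L(1)[OF s] L(1)[OF t]], of "1 / (s - t)"] L(2)[OF t]]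
      by (simp add: D_def[abs_def])
    define c where "c = 1 / (s - t)"
    note int = L2_mult_integrable[OF L(1)[OF s] \<psi>] L2_mult_integrable[OF L(1)[OF t] \<psi>]
      L2_mult_integrable[OF L(2)[OF t] \<psi>]
    have "D s x * \<psi> x = c * (u s x * \<psi> x - u t x * \<psi> x) - v t x * \<psi> x" for x
      by (simp add: D_def c_def left_diff_distrib)
    then have "(LINT x|lborel. D s x * \<psi> x)
        = (LINT x|lborel. c * (u s x * \<psi> x - u t x * \<psi> x) - v t x * \<psi> x)"
      by simp
    also have "\<dots> = c * (F s - F t) - V"
      unfolding F_def V_def
      by (simp only: Bochner_Integration.integral_diff integral_mult_right_zero
          integrable_mult_right Bochner_Integration.integrable_diff int)
    also have "\<dots> = (F s - F t) / (s - t) - V" by (simp add: c_def)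
    finally show ?thesis using L2_Cauchy_Schwarz[OF LD \<psi>] by simp
  qed
  have "((\<lambda>s. L2_nrm (D s) * L2_nrm \<psi>) \<longlongrightarrow> 0 * L2_nrm \<psi>) (at t within {1..<T})"
    using d t unfolding L2_time_derivative_def D_def by (intro tendsto_mult tendsto_const) auto
  note lim = this[unfolded mult_zero_left]
  have "((\<lambda>s. (F s - F t) / (s - t) - V) \<longlongrightarrow> 0) (at t within {1..<T})"
    by (rule Lim_null_comparison[OF _ lim]) (unfold eventually_at_filter, intro always_eventually allI impI bound)
  then have "((\<lambda>s. (F s - F t) / (s - t)) \<longlongrightarrow> V) (at t within {1..<T})"
    by (rule LIM_zero_cancel)
  then show ?thesis unfolding has_field_derivative_iff F_def V_def .
qed

lemma pairing_continuous:
  fixes v :: "real \<Rightarrow> 'a::euclidean_space \<Rightarrow> real"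
  assumes c: "C_L2 T v" and \<psi>: "L2 \<psi>"
  shows "continuous_on {1..<T} (\<lambda>t. LINT x|lborel. v t x * \<psi> x)"
  unfolding continuous_on_def
proof
  fix t assume t: "t \<in> {1..<T}"
  define V where "V t = (LINT x|lborel. v t x * \<psi> x)" for t
  have L: "L2 (v s)" if "s \<in> {1..<T}" for s
    using c that by (auto simp: C_L2_def)
  have bound: "norm (V s - V t) \<le> L2_nrm (\<lambda>x. v s x - v t x) * L2_nrm \<psi>" if s: "s \<in> {1..<T}" for s
  proof -
    have "(LINT x|lborel. (v s x - v t x) * \<psi> x) = V s - V t"
      unfolding V_def left_diff_distrib
      by (intro Bochner_Integration.integral_diff L2_mult_integrable L s t \<psi>)
    then show ?thesis using L2_Cauchy_Schwarz[OF L2_diff[OF L[OF s] L[OF t]] \<psi>] by simp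
  qed
  have "((\<lambda>s. L2_nrm (\<lambda>x. v s x - v t x) * L2_nrm \<psi>) \<longlongrightarrow> 0 * L2_nrm \<psi>) (at t within {1..<T})"
    using c t unfolding C_L2_def by (intro tendsto_mult tendsto_const) auto
  note lim = this[unfolded mult_zero_left]
  have "((\<lambda>s. V s - V t) \<longlongrightarrow> 0) (at t within {1..<T})"
    by (rule Lim_null_comparison[OF _ lim]) (unfold eventually_at_filter, intro always_eventually allI impI bound)
  then show "((\<lambda>t. LINT x|lborel. v t x * \<psi> x) \<longlongrightarrow> (LINT x|lborel. v t x * \<psi> x)) (at t within {1..<T})"
    unfolding V_def[symmetric] by (rule LIM_zero_cancel)
qed

section \<open>The exponential weight on balls\<close>

text \<open>The mass sits near the pole \<open>r e\<close>. At depth \<open>y = r - x \<bullet> e\<close> below it, the ball is contained in a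
  cube of side \<open>2 sqrt (2 r y)\<close> in the remaining \<open>N - 1\<close> directions, while the weight is \<open>exp (r - y)\<close>.
  Covering the slabs \<open>j \<le> y < j + 1\<close> by boxes leaves a convergent series times
  \<open>sqrt r ^ (N - 1) * exp r\<close>.\<close>

lemma exponential_ball_integral:
  fixes e :: "'a::euclidean_space"
  assumes e: "e \<in> Basis"
  obtains C where "0 < C" and
    "\<And>r. 0 \<le> r \<Longrightarrow> (LINT x:cball 0 r|lborel. exp (x \<bullet> e)) \<le> C * sqrt r ^ (DIM('a) - 1) * exp r"
proof -
  define n where "n = DIM('a) - 1"
  define q where "q = exp (- 1 / 2 :: real)"
  define D :: real where "D = (2 * sqrt 2) ^ n * (fact n * 2 ^ n * exp (1 / 2))"
  have q: "0 < q" "q < 1" by (auto simp: q_def)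
  have D: "0 < D" by (simp add: D_def)
  (* the factor exp (- j) outweighs the polynomial growth, with exp (- j / 2) to spare *)
  have slab: "exp (- real j) * sqrt (real j + 1) ^ n \<le> fact n * 2 ^ n * exp (1 / 2) * q ^ j" for j
  proof -
    have "sqrt (real j + 1) \<le> real j + 1"
      by (rule real_le_lsqrt) (auto simp: power2_eq_square)
    then have "sqrt (real j + 1) ^ n \<le> (real j + 1) ^ n"
      by (intro power_mono) auto
    also have "\<dots> = 2 ^ n * ((real j + 1) / 2) ^ n"
      by (simp add: power_divide)
    also have "\<dots> \<le> 2 ^ n * (fact n * exp ((real j + 1) / 2))"
      using power_div_fact_le_exp[of "(real j + 1) / 2" n]
      by (intro mult_left_mono) (auto simp: pos_divide_le_eq mult.commute)
    finally have "exp (- real j) * sqrt (real j + 1) ^ n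
        \<le> exp (- real j) * (2 ^ n * (fact n * exp ((real j + 1) / 2)))"
      by (intro mult_left_mono) auto
    also have "exp (- real j) * (2 ^ n * (fact n * exp ((real j + 1) / 2)))
        = fact n * 2 ^ n * (exp (- real j) * exp ((real j + 1) / 2))"
      by simp
    also have "exp (- real j) * exp ((real j + 1) / 2) = exp (1 / 2) * q ^ j"
      unfolding q_def by (simp add: exp_of_nat_mult[symmetric] exp_add[symmetric] field_simps)
    finally show ?thesis by (simp only: mult.assoc)
  qed
  have main: "(LINT x:cball 0 r|lborel. exp (x \<bullet> e)) \<le> D / (1 - q) * sqrt r ^ n * exp r"
    if r: "0 \<le> r" for r
  proof -
    (* half the side of the cube that contains the slab at depth j *)
    define h where "h j = sqrt (2 * r * (real j + 1))" for j
    define lo where "lo j = (\<Sum>b\<in>Basis. (if b = e then r - real j - 1 else - h j) *\<^sub>R b)" for j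
    define hi where "hi j = (\<Sum>b\<in>Basis. (if b = e then r - real j else h j) *\<^sub>R b)" for j
    define J where "J = nat \<lceil>2 * r\<rceil>"
    have h0: "0 \<le> h j" for j using r by (simp add: h_def)
    have lohi: "lo j \<bullet> b = (if b = e then r - real j - 1 else - h j)"
      "hi j \<bullet> b = (if b = e then r - real j else h j)" if "b \<in> Basis" for b j
      using that by (simp_all add: lo_def hi_def inner_sum_left_Basis)
    have vol: "measure lborel (cbox (lo j) (hi j)) = (2 * h j) ^ n" for j
    proof -
      have "measure lborel (cbox (lo j) (hi j)) = (\<Prod>b\<in>Basis. (hi j - lo j) \<bullet> b)"
        using h0[of j] by (subst measure_lborel_cbox_eq) (auto simp: lohi algebra_simps)
      also have "\<dots> = (\<Prod>b\<in>insert e (Basis - {e}). (hi j - lo j) \<bullet> b)"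
        using e by (simp add: insert_absorb)
      also have "\<dots> = (\<Prod>b\<in>Basis - {e}. (hi j - lo j) \<bullet> b)"
        using e by (subst prod.insert) (auto simp: lohi inner_diff_left)
      also have "\<dots> = (\<Prod>b\<in>Basis - {e}. 2 * h j)"
        by (intro prod.cong) (auto simp: lohi inner_diff_left)
      also have "\<dots> = (2 * h j) ^ n"
        using e by (simp add: n_def)
      finally show ?thesis .
    qed
    have box: "integrable lborel (indicator (cbox (lo j) (hi j)) :: 'a \<Rightarrow> real)" for j
      by (intro integrable_real_indicator emeasure_lborel_cbox_finite) auto
    have cover: "indicator (cball 0 r) x * exp (x \<bullet> e)
        \<le> (\<Sum>j\<le>J. exp (r - real j) * indicator (cbox (lo j) (hi j)) x)" for x :: 'a
    proof (cases "norm x \<le> r")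
      case True
      define y where "y = r - x \<bullet> e"
      define j where "j = nat \<lfloor>y\<rfloor>"
      have xe: "\<bar>x \<bullet> e\<bar> \<le> r" using Basis_le_norm[OF e, of x] True by linarith
      then have y: "0 \<le> y" "y \<le> 2 * r" by (auto simp: y_def)
      have j: "real j \<le> y" "y < real j + 1" using y by (auto simp: j_def)
      have "j \<le> J" unfolding j_def J_def using y(2) by linarith
      have "\<bar>x \<bullet> b\<bar> \<le> h j" if b: "b \<in> Basis" "b \<noteq> e" for b
      proof -
        have "(\<Sum>c\<in>{b, e}. (x \<bullet> c)\<^sup>2) \<le> (\<Sum>c\<in>Basis. (x \<bullet> c)\<^sup>2)"
          using b e by (intro sum_mono2) auto
        moreover have "(norm x)\<^sup>2 = (\<Sum>c\<in>Basis. (x \<bullet> c)\<^sup>2)"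
          unfolding power2_norm_eq_inner by (subst euclidean_inner) (simp only: power2_eq_square)
        ultimately have "(x \<bullet> b)\<^sup>2 + (x \<bullet> e)\<^sup>2 \<le> (norm x)\<^sup>2"
          using b by simp
        also have "\<dots> \<le> r\<^sup>2" using True by (intro power_mono) auto
        finally have "(x \<bullet> b)\<^sup>2 \<le> r\<^sup>2 - (r - y)\<^sup>2" by (simp add: y_def)
        also have "\<dots> \<le> 2 * r * y" by (simp add: power2_eq_square algebra_simps)
        also have "\<dots> \<le> 2 * r * (real j + 1)" using j r by (intro mult_left_mono) auto
        finally show ?thesis unfolding h_def by (metis real_le_rsqrt power2_abs)
      qed
      then have "x \<in> cbox (lo j) (hi j)"
        using j by (force simp: mem_box lohi y_def abs_le_iff)
      have "indicator (cball 0 r) x * exp (x \<bullet> e) \<le> exp (r - real j)"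
        using j True by (simp add: y_def)
      also have "\<dots> = exp (r - real j) * indicator (cbox (lo j) (hi j)) x"
        using \<open>x \<in> cbox (lo j) (hi j)\<close> by simp
      also have "\<dots> \<le> (\<Sum>j\<le>J. exp (r - real j) * indicator (cbox (lo j) (hi j)) x)"
        using \<open>j \<le> J\<close> by (intro member_le_sum) auto
      finally show ?thesis .
    qed (auto intro!: sum_nonneg)
    have "(LINT x:cball 0 r|lborel. exp (x \<bullet> e))
        \<le> (LINT x|lborel. (\<Sum>j\<le>J. exp (r - real j) * indicator (cbox (lo j) (hi j)) x))"
      unfolding set_lebesgue_integral_def
    proof (rule integral_mono)
      show "integrable lborel (\<lambda>x. indicator (cball 0 r) x *\<^sub>R exp (x \<bullet> e))"
        using borel_integrable_compact[of "cball 0 r" "\<lambda>x. exp (x \<bullet> e)"]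
          continuous_on_exp[OF continuous_on_inner[OF continuous_on_id continuous_on_const]] by auto
      show "integrable lborel (\<lambda>x. \<Sum>j\<le>J. exp (r - real j) * indicator (cbox (lo j) (hi j)) x)"
        by (intro Bochner_Integration.integrable_sum integrable_mult_right box)
    qed (use cover in auto)
    also have "\<dots> = (\<Sum>j\<le>J. exp (r - real j) * (2 * h j) ^ n)"
      by (subst Bochner_Integration.integral_sum) (auto intro!: integrable_mult_right box simp: vol)
    also have "\<dots> \<le> (\<Sum>j\<le>J. sqrt r ^ n * exp r * D * q ^ j)"
    proof (rule sum_mono)
      fix j
      have "exp (r - real j) * (2 * h j) ^ n
          = sqrt r ^ n * exp r * (2 * sqrt 2) ^ n * (exp (- real j) * sqrt (real j + 1) ^ n)"
        unfolding h_def real_sqrt_mult power_mult_distrib exp_diff exp_minus divide_inverse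
        by (simp only: mult_ac)
      also have "\<dots> \<le> sqrt r ^ n * exp r * (2 * sqrt 2) ^ n * (fact n * 2 ^ n * exp (1 / 2) * q ^ j)"
        using r by (intro mult_left_mono slab) auto
      finally show "exp (r - real j) * (2 * h j) ^ n \<le> sqrt r ^ n * exp r * D * q ^ j"
        by (simp only: D_def mult.assoc)
    qed
    also have "\<dots> = sqrt r ^ n * exp r * D * (\<Sum>j\<le>J. q ^ j)"
      by (simp only: sum_distrib_left)
    also have "\<dots> \<le> sqrt r ^ n * exp r * D * (1 / (1 - q))"
    proof (rule mult_left_mono)
      have "(\<Sum>j\<le>J. q ^ j) \<le> (\<Sum>j. q ^ j)"
        using q by (intro sum_le_suminf summable_geometric) auto
      then show "(\<Sum>j\<le>J. q ^ j) \<le> 1 / (1 - q)" using q by (simp add: suminf_geometric)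
    qed (use r D in auto)
    finally show ?thesis by (simp add: field_simps)
  qed
  show thesis
    by (rule that[of "D / (1 - q)"]) (use main q D in \<open>auto simp: n_def\<close>)
qed

section \<open>The linear inequality and its growing mode\<close>

lemma nondecreasing_within:
  fixes f :: "real \<Rightarrow> real"
  assumes "\<And>t. t \<in> {a..b} \<Longrightarrow> (f has_real_derivative f' t) (at t within {a..b})"
    and "\<And>x. s < x \<Longrightarrow> x < t \<Longrightarrow> 0 \<le> f' x"
    and "s \<in> {a..b}" "t \<in> {a..b}" "s \<le> t"
  shows "f s \<le> f t"
proof (rule DERIV_nonneg_imp_increasing_open[OF assms(5)])
  fix x assume x: "s < x" "x < t"
  then have "x \<in> interior {a..b}" using assms(3,4) by auto
  then have "DERIV f x :> f' x"
    using assms(1)[of x] x assms(3,4) at_within_interior[of x "{a..b}"] by auto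
  then show "\<exists>y. DERIV f x :> y \<and> 0 \<le> y" using assms(2)[of x] x assms(3,4) by auto
next
  have "continuous_on {a..b} f"
    using assms(1) by (rule DERIV_continuous_on)
  then show "continuous_on {s..t} f"
    by (rule continuous_on_subset) (use assms(3,4) in auto)
qed

text \<open>The average \<open>W\<close> of a weak solution is only the sum of a \<open>C\<^sup>1\<close> function and a monotone one, so the
  product rule for \<open>\<alpha> W\<close> is not available. For an increasing weight it survives as an inequality, since
  \<open>\<integral>\<^sub>a\<^sup>t \<alpha>' M \<le> (\<alpha> t - \<alpha> a) M t\<close> when \<open>M\<close> is increasing.\<close>

lemma weighted_growth:
  fixes W \<alpha> h M :: "real \<Rightarrow> real"
  assumes W: "continuous_on {a..b} W" and h: "continuous_on {a..b} h"
    and M: "mono_on {a..b} M" and Ma: "M a = 0"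
    and eq: "\<And>t. t \<in> {a..b} \<Longrightarrow> W t = W a + integral {a..t} h + M t"
    and \<alpha>: "\<And>t. t \<in> {a..b} \<Longrightarrow> (\<alpha> has_real_derivative \<alpha>' t) (at t within {a..b})"
    and \<alpha>': "continuous_on {a..b} \<alpha>'" "\<And>t. t \<in> {a..b} \<Longrightarrow> 0 \<le> \<alpha>' t"
    and \<alpha>a: "0 \<le> \<alpha> a" and t: "t \<in> {a..b}"
  shows "\<alpha> a * W a + integral {a..t} (\<lambda>s. \<alpha>' s * W s + \<alpha> s * h s) \<le> \<alpha> t * W t"
proof -
  (* the continuously differentiable part of W *)
  define w where "w s = W a + integral {a..s} h" for s
  have at: "a \<le> t" "{a..t} \<subseteq> {a..b}" using t by auto
  have dw: "(w has_real_derivative h s) (at s within {a..b})" if "s \<in> {a..b}" for s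
    unfolding w_def using that h by (auto intro!: derivative_eq_intros integral_has_real_derivative)
  have cw: "continuous_on {a..t} w" and c\<alpha>: "continuous_on {a..t} \<alpha>"
    using DERIV_continuous_on[OF dw] DERIV_continuous_on[OF \<alpha>] at(2)
    by (auto intro: continuous_on_subset)
  note ch = continuous_on_subset[OF h at(2)] and c\<alpha>' = continuous_on_subset[OF \<alpha>'(1) at(2)]
    and cW = continuous_on_subset[OF W at(2)]
  have "((\<lambda>s. \<alpha>' s * w s + \<alpha> s * h s) has_integral (\<alpha> t * w t - \<alpha> a * w a)) {a..t}"
  proof (rule fundamental_theorem_of_calculus[OF at(1)])
    fix s assume s: "s \<in> {a..t}"
    have "((\<lambda>s. \<alpha> s * w s) has_real_derivative \<alpha>' s * w s + \<alpha> s * h s) (at s within {a..b})"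
      using DERIV_mult[OF \<alpha> dw, of s] s at by (auto simp: algebra_simps)
    then show "((\<lambda>s. \<alpha> s * w s) has_vector_derivative \<alpha>' s * w s + \<alpha> s * h s) (at s within {a..t})"
      using at(2) has_field_derivative_subset has_real_derivative_iff_has_vector_derivative by blast
  qed
  then have I1: "integral {a..t} (\<lambda>s. \<alpha>' s * w s + \<alpha> s * h s) = \<alpha> t * w t - \<alpha> a * W a"
    by (simp add: integral_unique w_def)
  have "(\<alpha>' has_integral (\<alpha> t - \<alpha> a)) {a..t}"
    by (rule fundamental_theorem_of_calculus[OF at(1)])
      (meson \<alpha> at(2) has_field_derivative_subset has_real_derivative_iff_has_vector_derivative subsetD)
  then have I2: "integral {a..t} (\<lambda>s. \<alpha>' s * M t) = (\<alpha> t - \<alpha> a) * M t"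
    using has_integral_mult_left integral_unique by blast
  have M0: "0 \<le> M t" using mono_onD[OF M, of a t] t Ma by auto
  have MW: "W s = w s + M s" if "s \<in> {a..t}" for s
    using eq[of s] that at by (auto simp: w_def)
  have "integral {a..t} (\<lambda>s. \<alpha>' s * (W s - w s)) \<le> integral {a..t} (\<lambda>s. \<alpha>' s * M t)"
  proof (rule integral_le)
    show "\<alpha>' s * (W s - w s) \<le> \<alpha>' s * M t" if "s \<in> {a..t}" for s
      using MW[OF that] mono_onD[OF M, of s t] that at t \<alpha>'(2)[of s]
      by (intro mult_left_mono) auto
  qed (intro integrable_continuous_real continuous_intros cW cw c\<alpha>')+
  also have "\<dots> \<le> \<alpha> t * M t"
    using I2 mult_nonneg_nonneg[OF \<alpha>a M0] by (simp add: algebra_simps)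
  finally have I3: "integral {a..t} (\<lambda>s. \<alpha>' s * (W s - w s)) \<le> \<alpha> t * M t" .
  have "integral {a..t} (\<lambda>s. \<alpha>' s * W s + \<alpha> s * h s) =
      integral {a..t} (\<lambda>s. (\<alpha>' s * w s + \<alpha> s * h s) + \<alpha>' s * (W s - w s))"
    by (simp add: algebra_simps)
  also have "\<dots> = integral {a..t} (\<lambda>s. \<alpha>' s * w s + \<alpha> s * h s) + integral {a..t} (\<lambda>s. \<alpha>' s * (W s - w s))"
    by (intro integral_add integrable_continuous_real continuous_intros cW cw c\<alpha>' c\<alpha> ch)
  also have "\<dots> \<le> \<alpha> t * w t - \<alpha> a * W a + \<alpha> t * M t"
    using I1 I3 by simp
  also have "\<dots> = \<alpha> t * W t - \<alpha> a * W a"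
    using MW[of t] at by (simp add: algebra_simps)
  finally show ?thesis by simp
qed

text \<open>With the weight \<open>t powr \<mu>\<close> the damping disappears, and \<open>t powr \<mu> * W\<close> grows as long as \<open>F\<close> is
  positive, while \<open>F\<close> grows as long as \<open>W\<close> is positive: neither can be the first to vanish. The
  integral lower bound for \<open>t powr \<mu> * W\<close> then defines a continuously differentiable \<open>w \<le> W\<close> that solves the
  damped equation exactly, so everything that follows is classical calculus with \<open>w\<close>.\<close>

lemma positivity_and_smooth_minorant:
  fixes F W Q M :: "real \<Rightarrow> real" and k \<mu> T :: real
  assumes \<mu>: "0 < \<mu>" and T: "1 \<le> T"
    and F: "\<And>t. t \<in> {1..T} \<Longrightarrow> (F has_real_derivative W t) (at t within {1..T})"
    and W: "continuous_on {1..T} W"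
    and Q: "continuous_on {1..T} Q" "\<And>t. t \<in> {1..T} \<Longrightarrow> 0 \<le> Q t"
    and M: "mono_on {1..T} M" "M 1 = 0"
    and eq: "\<And>t. t \<in> {1..T} \<Longrightarrow>
      W t = W 1 + integral {1..t} (\<lambda>s. s powr (- 2 * k) * F s - \<mu> / s * W s + Q s) + M t"
    and pos: "0 < F 1" "0 < W 1"
  obtains w where "w 1 = W 1" and "\<And>t. t \<in> {1..T} \<Longrightarrow> 0 < F t"
    and "\<And>t. t \<in> {1..T} \<Longrightarrow> 0 < w t" and "\<And>t. t \<in> {1..T} \<Longrightarrow> w t \<le> W t"
    and "\<And>t. t \<in> {1..T} \<Longrightarrow> (w has_real_derivative
      t powr (- 2 * k) * F t - \<mu> / t * w t + Q t) (at t within {1..T})"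
proof -
  have cF: "continuous_on {1..T} F" using F by (rule DERIV_continuous_on)
  define G where "G s = s powr \<mu> * (s powr (- 2 * k) * F s + Q s)" for s
  have cG: "continuous_on {1..T} G"
    unfolding G_def[abs_def] by (intro continuous_intros cF Q) auto
  have grow: "W 1 + integral {1..t} G \<le> t powr \<mu> * W t" if t: "t \<in> {1..T}" for t
  proof -
    have "1 powr \<mu> * W 1 + integral {1..t} (\<lambda>s. (\<mu> * s powr (\<mu> - 1)) * W s
        + s powr \<mu> * (s powr (- 2 * k) * F s - \<mu> / s * W s + Q s)) \<le> t powr \<mu> * W t"
    proof (rule weighted_growth[OF W _ M eq _ _ _ _ t])
      show "continuous_on {1..T} (\<lambda>s. s powr (- 2 * k) * F s - \<mu> / s * W s + Q s)"
        by (intro continuous_intros cF W Q) auto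
      show "((\<lambda>t. t powr \<mu>) has_real_derivative \<mu> * s powr (\<mu> - 1)) (at s within {1..T})"
        if "s \<in> {1..T}" for s
        using that by (auto intro!: derivative_eq_intros)
      show "continuous_on {1..T} (\<lambda>s. \<mu> * s powr (\<mu> - 1))"
        by (intro continuous_intros) auto
    qed (use \<mu> in auto)
    moreover have "integral {1..t} (\<lambda>s. (\<mu> * s powr (\<mu> - 1)) * W s
        + s powr \<mu> * (s powr (- 2 * k) * F s - \<mu> / s * W s + Q s)) = integral {1..t} G"
      by (rule integral_cong) (auto simp: G_def powr_diff algebra_simps)
    ultimately show ?thesis by simp
  qed
  have Wpos_of: "0 < W t" if t: "t \<in> {1..T}" and below: "\<And>s. s \<in> {1..t} \<Longrightarrow> 0 \<le> F s" for t
  proof -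
    have "0 \<le> integral {1..t} G"
    proof (rule integral_nonneg)
      show "G integrable_on {1..t}"
        by (intro integrable_continuous_real continuous_on_subset[OF cG]) (use t in auto)
    qed (use below Q(2) t in \<open>auto simp: G_def\<close>)
    then have "0 < t powr \<mu> * W t" using grow[OF t] pos by linarith
    then show ?thesis by (simp add: zero_less_mult_iff)
  qed
  have Fmono: "F 1 \<le> F t" if t: "t \<in> {1..T}" and below: "\<And>s. s \<in> {1<..<t} \<Longrightarrow> 0 \<le> W s" for t
    by (rule nondecreasing_within[of 1 T F W]) (use F t below in auto)
  have Wpos: "0 < W t" if t: "t \<in> {1..T}" for t
  proof (rule ccontr)
    assume "\<not> 0 < W t"
    (* the times at which W fails to be positive form a closed set, so there is a first one *)
    define Z where "Z = {1..T} \<inter> W -` {..0}"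
    have "closed Z"
      unfolding Z_def by (rule continuous_closed_preimage[OF W]) auto
    moreover have "Z \<noteq> {}" "bdd_below Z"
      using t \<open>\<not> 0 < W t\<close> by (auto simp: Z_def intro: bdd_belowI[of _ 1])
    ultimately have InfZ: "Inf Z \<in> Z" using closed_contains_Inf by blast
    have before: "0 < W s" if "s \<in> {1..<Inf Z}" for s
      using that InfZ cInf_lower[OF _ \<open>bdd_below Z\<close>, of s] by (force simp: Z_def)
    have "0 \<le> F s" if s: "s \<in> {1..Inf Z}" for s
    proof -
      have "F 1 \<le> F s"
        by (rule Fmono) (use s InfZ before in \<open>auto simp: Z_def less_imp_le\<close>)
      then show ?thesis using pos by simp
    qed
    then have "0 < W (Inf Z)" using InfZ by (intro Wpos_of) (auto simp: Z_def)
    then show False using InfZ by (simp add: Z_def)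
  qed
  have Fpos: "0 < F t" if "t \<in> {1..T}" for t
    by (rule less_le_trans[OF pos(1) Fmono[OF that]]) (use Wpos that in \<open>auto intro: less_imp_le\<close>)
  define w where "w t = t powr (- \<mu>) * (W 1 + integral {1..t} G)" for t
  show thesis
  proof
    show "w 1 = W 1" by (simp add: w_def)
    fix t assume t: "t \<in> {1..T}"
    show "0 < F t" by (rule Fpos[OF t])
    have "0 \<le> integral {1..t} G"
    proof (rule integral_nonneg)
      show "G integrable_on {1..t}"
        by (intro integrable_continuous_real continuous_on_subset[OF cG]) (use t in auto)
    qed (use Fpos Q(2) t in \<open>auto simp: G_def less_imp_le\<close>)
    then show "0 < w t" using pos t by (simp add: w_def)
    show "w t \<le> W t"
      using grow[OF t] t by (simp add: w_def powr_minus field_simps)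
    have "(w has_real_derivative (- \<mu> * t powr (- \<mu> - 1)) * (W 1 + integral {1..t} G)
        + t powr (- \<mu>) * G t) (at t within {1..T})"
      unfolding w_def using t
      by (auto intro!: derivative_eq_intros integral_has_real_derivative[OF cG])
    moreover have "(- \<mu> * t powr (- \<mu> - 1)) * (W 1 + integral {1..t} G) = - \<mu> / t * w t"
      using t by (simp add: w_def powr_diff)
    moreover have "t powr (- \<mu>) * G t = t powr (- 2 * k) * F t + Q t"
      using t by (simp add: G_def powr_minus)
    ultimately show "(w has_real_derivative t powr (- 2 * k) * F t - \<mu> / t * w t + Q t)
        (at t within {1..T})"
      by (simp add: algebra_simps)
  qed
qed

text \<open>The reciprocal of the size that \<open>W\<close> has for growing solutions of the linear equation, found by the
  WKB ansatz.\<close>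

definition amp :: "real \<Rightarrow> real \<Rightarrow> real \<Rightarrow> real" where
  "amp k \<mu> t = t powr ((k + \<mu>) / 2) * exp (- \<phi>k k t)"

lemma powr_has_real_derivative_within:
  assumes "0 < (t::real)"
  shows "((\<lambda>t. t powr c) has_real_derivative c * (t powr c / t)) (at t within X)"
  using has_real_derivative_powr[OF assms, of c] assms
  by (auto simp: powr_diff intro: DERIV_subset)

lemma \<phi>k_has_real_derivative:
  assumes "k < 1" "0 < t"
  shows "(\<phi>k k has_real_derivative t powr (- k)) (at t within X)"
proof -
  have "(\<phi>k k has_real_derivative (1 - k) * (t powr (1 - k) / t) / (1 - k)) (at t within X)"
    unfolding \<phi>k_def[abs_def] by (intro DERIV_cdivide powr_has_real_derivative_within assms)
  then show ?thesis
    by (rule DERIV_cong) (use assms in \<open>simp add: powr_diff powr_minus_divide\<close>)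
qed

lemma amp_pos: "0 < t \<Longrightarrow> 0 < amp k \<mu> t"
  by (simp add: amp_def)

lemma amp_has_real_derivative:
  assumes "k < 1" "0 < t"
  shows "(amp k \<mu> has_real_derivative amp k \<mu> t * ((k + \<mu>) / (2 * t) - t powr (- k))) (at t within X)"
proof -
  have "(amp k \<mu> has_real_derivative
      ((k + \<mu>) / 2 * (t powr ((k + \<mu>) / 2) / t)) * exp (- \<phi>k k t)
      + (exp (- \<phi>k k t) * (- (t powr (- k)))) * t powr ((k + \<mu>) / 2)) (at t within X)"
    unfolding amp_def[abs_def]
    by (intro DERIV_mult powr_has_real_derivative_within assms
        DERIV_chain2[OF DERIV_exp] DERIV_minus \<phi>k_has_real_derivative)
  then show ?thesis
    by (rule DERIV_cong) (use assms in \<open>simp add: amp_def field_simps\<close>)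
qed

text \<open>The classical differential inequalities left after the passage from \<open>W\<close> to its smooth minorant \<open>w\<close>;
  \<open>Q\<close> is the forcing.\<close>

definition minorant_system ::
    "real \<Rightarrow> real \<Rightarrow> real \<Rightarrow> (real \<Rightarrow> real) \<Rightarrow> (real \<Rightarrow> real) \<Rightarrow> (real \<Rightarrow> real) \<Rightarrow> (real \<Rightarrow> real) \<Rightarrow> bool"
  where "minorant_system k \<mu> T F W w Q \<longleftrightarrow> continuous_on {1..T} Q \<and>
    (\<forall>t\<in>{1..T}. 0 < F t \<and> 0 < w t \<and> w t \<le> W t \<and> 0 \<le> Q t \<and>
      (F has_real_derivative W t) (at t within {1..T}) \<and>
      (w has_real_derivative t powr (- 2 * k) * F t - \<mu> / t * w t + Q t) (at t within {1..T}))"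

text \<open>With \<open>q = \<beta> w\<close>, \<open>r = \<beta> t powr (- k) F\<close> and \<open>m = (\<mu> - k) / 2\<close>, the linear system reads
  \<open>q' = - (m/t) q + t powr (- k) (r - q) + \<beta> Q\<close> and \<open>r' \<ge> (m/t) r + t powr (- k) (q - r)\<close>. The sum
  \<open>q + r\<close> would be conserved apart from the forcing if \<open>m\<close> were zero. For general \<open>m\<close> the correction
  \<open>q + \<theta> r\<close> with \<open>\<theta> = 1 + m t powr (k - 1)\<close> removes the error of order \<open>1/t\<close>; what remains is of
  order \<open>t powr (k - 2)\<close>, integrable because \<open>k < 1\<close>, and the bounded factor \<open>\<eta>\<close> absorbs it. Hence
  \<open>q + \<theta> r\<close> dominates \<open>A\<close>, the factor next to \<open>\<delta>\<close> below: initial data plus accumulated forcing. Finally the coupling drives \<open>q\<close> towards \<open>r\<close>, which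
  turns the bound on the combination into a bound on \<open>q\<close> alone. The condition that relates \<open>\<delta>\<close> to \<open>w 1\<close> and
  \<open>F 1\<close> is this last bound at time \<open>1\<close>.\<close>

lemma outgoing_wave_lower_bound:
  fixes k \<mu> :: real
  assumes k: "0 \<le> k" "k < 1" and \<mu>: "0 < \<mu>"
  obtains K\<^sub>0 \<eta> \<delta>\<^sub>0 where "0 < K\<^sub>0" "0 < \<eta>" "0 < \<delta>\<^sub>0" and
    "\<And>T F W w Q \<delta> t. \<lbrakk>minorant_system k \<mu> T F W w Q; 0 < \<delta>; \<delta> \<le> \<delta>\<^sub>0;
      \<delta> * (w 1 + K\<^sub>0 * F 1) \<le> w 1; t \<in> {1..T}\<rbrakk> \<Longrightarrow>
      \<delta> * (\<eta> * (amp k \<mu> 1 * (w 1 + K\<^sub>0 * F 1) + integral {1..t} (\<lambda>s. amp k \<mu> s * Q s)))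
        \<le> amp k \<mu> t * w t"
proof -
  (* C is twice the coefficient of the remaining error, since theta can be as small as 1/2;
     K bounds the decay rate of q relative to t powr (- k), and k0 is a lower bound for 1 / theta. *)
  define m where "m = (\<mu> - k) / 2"
  define C where "C = 2 * \<bar>m * (k - 1 + m)\<bar>"
  define \<theta> where "\<theta> t = 1 + m * t powr (k - 1)" for t :: real
  define \<eta> where "\<eta> t = exp (- C * (t powr (k - 1) / (1 - k)))" for t :: real
  define \<beta> where "\<beta> = amp k \<mu>"
  define K where "K = \<bar>m\<bar> + 3"
  define k0 where "k0 = 1 / (1 + \<bar>m\<bar>)"
  (* this bound keeps theta away from 0 even when the damping is weaker than k *)
  have m: "- 1 / 2 < m" using k \<mu> by (simp add: m_def)
  have C: "0 \<le> C" by (simp add: C_def)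
  have pw: "t powr (k - 1) \<le> 1" "0 < t powr (k - 1)" if "1 \<le> t" for t :: real
    using powr_mono[of "k - 1" 0 t] that k by auto
  have \<theta>: "1 / 2 \<le> \<theta> t" "\<theta> t \<le> 1 + \<bar>m\<bar>" if "1 \<le> t" for t
  proof -
    have "\<bar>m * t powr (k - 1)\<bar> \<le> \<bar>m\<bar>"
      using pw[OF that] by (simp add: abs_mult mult_left_le)
    then show "\<theta> t \<le> 1 + \<bar>m\<bar>" by (simp add: \<theta>_def)
    show "1 / 2 \<le> \<theta> t"
    proof (cases "0 \<le> m")
      case True
      then show ?thesis using pw[OF that] by (simp add: \<theta>_def add_increasing2)
    next
      case False
      then show ?thesis using \<open>\<bar>m * t powr (k - 1)\<bar> \<le> \<bar>m\<bar>\<close> m by (simp add: \<theta>_def)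
    qed
  qed
  have d\<theta>: "(\<theta> has_real_derivative m * ((k - 1) * (t powr (k - 1) / t))) (at t within X)" if "1 \<le> t" for t X
  proof -
    have "(\<theta> has_real_derivative 0 + m * ((k - 1) * (t powr (k - 1) / t))) (at t within X)"
      unfolding \<theta>_def[abs_def]
      by (intro DERIV_add DERIV_const DERIV_cmult powr_has_real_derivative_within) (use that in auto)
    then show ?thesis by simp
  qed
  have d\<eta>: "(\<eta> has_real_derivative \<eta> t * (C * (t powr (k - 1) / t))) (at t within X)" if "1 \<le> t" for t X
  proof -
    have "(\<eta> has_real_derivative \<eta> t * (- C * ((k - 1) * (t powr (k - 1) / t) / (1 - k)))) (at t within X)"
      unfolding \<eta>_def[abs_def]
      by (intro DERIV_chain2[OF DERIV_exp] DERIV_cmult DERIV_cdivide powr_has_real_derivative_within)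
        (use that in auto)
    moreover have "- C * ((k - 1) * (t powr (k - 1) / t) / (1 - k)) = C * (t powr (k - 1) / t)"
      using k that by (simp add: field_simps)
    ultimately show ?thesis by (simp only:)
  qed
  have \<eta>: "\<eta> 1 \<le> \<eta> t" "\<eta> t \<le> 1" "0 < \<eta> t" if "1 \<le> t" for t
  proof -
    have "C * (t powr (k - 1) / (1 - k)) \<le> C * (1 / (1 - k))"
      using pw[OF that] C k by (intro mult_left_mono divide_right_mono) auto
    then show "\<eta> 1 \<le> \<eta> t" by (simp add: \<eta>_def)
    show "\<eta> t \<le> 1" "0 < \<eta> t" using pw[OF that] C k by (auto simp: \<eta>_def)
  qed
  have main: "\<delta> * (\<eta> 1 * (\<beta> 1 * (w 1 + (1 + m) * F 1) + integral {1..t} (\<lambda>s. \<beta> s * Q s))) \<le> \<beta> t * w t"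
    if sys: "minorant_system k \<mu> T F W w Q"
      and \<delta>: "0 < \<delta>" "\<delta> \<le> min 1 (k0 / K)" "\<delta> * (w 1 + (1 + m) * F 1) \<le> w 1"
      and t: "t \<in> {1..T}"
    for T F W w Q \<delta> t
  proof -
    have T: "1 \<le> T" using t by simp
    have dF: "(F has_real_derivative W t) (at t within {1..T})"
      and dw: "(w has_real_derivative t powr (- 2 * k) * F t - \<mu> / t * w t + Q t) (at t within {1..T})"
      and Fpos: "0 < F t" and wW: "0 < w t \<and> w t \<le> W t" and Q0: "0 \<le> Q t"
      if "t \<in> {1..T}" for t
      using sys that by (simp_all add: minorant_system_def)
    have cQ: "continuous_on {1..T} Q" using sys by (simp add: minorant_system_def)
    have F1: "0 < F 1" and w1: "0 < w 1" using Fpos[of 1] wW[of 1] T by auto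
    define A where "A t = \<eta> 1 * (\<beta> 1 * (w 1 + (1 + m) * F 1) + integral {1..t} (\<lambda>s. \<beta> s * Q s))" for t
    define r where "r t = \<beta> t * t powr (- k) * F t" for t
    define q where "q t = \<beta> t * w t" for t
    have \<beta>: "0 < \<beta> t" if "1 \<le> t" for t using that by (simp add: \<beta>_def amp_pos)
    have c\<beta>Q: "continuous_on {1..T} (\<lambda>s. \<beta> s * Q s)"
      by (intro continuous_on_mult cQ DERIV_continuous_on[of _ \<beta>])
        (use k in \<open>auto simp: \<beta>_def intro!: amp_has_real_derivative\<close>)
    have dA: "(A has_real_derivative \<eta> 1 * (\<beta> t * Q t)) (at t within {1..T})" if "t \<in> {1..T}" for t
      unfolding A_def[abs_def] using that
      by (auto intro!: derivative_eq_intros integral_has_real_derivative[OF c\<beta>Q])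
    have A1: "A 1 = \<eta> 1 * (\<beta> 1 * (w 1 + (1 + m) * F 1))" by (simp add: A_def)
    have dq: "(q has_real_derivative - (m / t + t powr (- k)) * q t + t powr (- k) * r t + \<beta> t * Q t)
        (at t within {1..T})" if t: "t \<in> {1..T}" for t
    proof -
      have "(q has_real_derivative \<beta> t * ((k + \<mu>) / (2 * t) - t powr (- k)) * w t
          + (t powr (- 2 * k) * F t - \<mu> / t * w t + Q t) * \<beta> t) (at t within {1..T})"
        unfolding q_def[abs_def] \<beta>_def
        by (intro DERIV_mult dw amp_has_real_derivative) (use t k in auto)
      moreover have "t powr (- 2 * k) = t powr (- k) * t powr (- k)"
        by (simp flip: powr_add)
      ultimately show ?thesis
        by (elim DERIV_cong) (use t in \<open>simp add: q_def r_def m_def field_simps\<close>)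
    qed
    have dr: "(r has_real_derivative (m / t - t powr (- k)) * r t + t powr (- k) * (\<beta> t * W t))
        (at t within {1..T})" if t: "t \<in> {1..T}" for t
    proof -
      have "(r has_real_derivative (\<beta> t * ((k + \<mu>) / (2 * t) - t powr (- k)) * t powr (- k)
          + (- k * (t powr (- k) / t)) * \<beta> t) * F t + W t * (\<beta> t * t powr (- k))) (at t within {1..T})"
        unfolding r_def[abs_def] \<beta>_def
        by (intro DERIV_mult dF amp_has_real_derivative powr_has_real_derivative_within) (use t k in auto)
      then show ?thesis
        by (rule DERIV_cong) (use t in \<open>simp add: r_def m_def field_simps\<close>)
    qed
    have qr: "0 < q t" "0 < r t" if "t \<in> {1..T}" for t
      using that wW[OF that] Fpos[OF that] \<beta>[of t] by (auto simp: q_def r_def)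
    define S where "S t = \<eta> t * (q t + \<theta> t * r t)" for t
    have "A t \<le> S t" if t: "t \<in> {1..T}" for t
    proof -
      define D where "D t = \<eta> t * (C * (t powr (k - 1) / t)) * (q t + \<theta> t * r t)
        + ((- (m / t + t powr (- k)) * q t + t powr (- k) * r t + \<beta> t * Q t)
          + (m * ((k - 1) * (t powr (k - 1) / t)) * r t
            + ((m / t - t powr (- k)) * r t + t powr (- k) * (\<beta> t * W t)) * \<theta> t)) * \<eta> t
        - \<eta> 1 * (\<beta> t * Q t)" for t
      have "S 1 - A 1 \<le> S t - A t"
      proof (rule nondecreasing_within[of 1 T "\<lambda>t. S t - A t" D])
        show "((\<lambda>t. S t - A t) has_real_derivative D t) (at t within {1..T})" if "t \<in> {1..T}" for t
          unfolding S_def D_def using that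
          by (intro DERIV_diff DERIV_mult DERIV_add d\<eta> d\<theta> dq dr dA) auto
        fix s assume "1 < s" "s < t"
        then have s: "s \<in> {1..T}" "1 \<le> s" using t by auto
        define a where "a = s powr (- k)"
        define c where "c = s powr (k - 1)"
        have a0: "0 < a" and c0: "0 < c" and ac: "a * c = 1 / s"
          using s by (auto simp: a_def c_def powr_minus_divide powr_diff)
        (* F grows at rate W, which is at least w *)
        have "q s \<le> \<beta> s * W s"
          using wW[OF s(1)] \<beta>[OF s(2)] by (simp add: q_def)
        then have W_ge: "a * \<theta> s * q s \<le> a * \<theta> s * (\<beta> s * W s)"
          using a0 \<theta>[OF s(2)] by (intro mult_left_mono) auto
        have a\<theta>: "a * \<theta> s = a + m * (a * c)"
          by (simp add: \<theta>_def c_def algebra_simps)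
        have "\<bar>m * (k - 1 + m)\<bar> \<le> C * \<theta> s"
          using mult_left_mono[OF \<theta>(1)[OF s(2)], of C] by (simp add: C_def)
        then have "0 \<le> C * \<theta> s + m * (k - 1 + m)" by linarith
        then have "0 \<le> c * (a * c) * (C * \<theta> s + m * (k - 1 + m)) * r s"
          using a0 c0 qr[OF s(1)] by simp
        moreover have "0 \<le> C * (c * (a * c)) * q s"
          using a0 c0 C qr[OF s(1)] by simp
        moreover have "C * (c * (a * c)) * (q s + \<theta> s * r s) - (m * (a * c) + a) * q s + a * r s
            + m * ((k - 1) * (c * (a * c))) * r s + (m * (a * c) - a) * r s * \<theta> s + (a * \<theta> s) * q s
            = C * (c * (a * c)) * q s + c * (a * c) * (C * \<theta> s + m * (k - 1 + m)) * r s"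
          by (simp add: a\<theta>, simp add: \<theta>_def c_def[symmetric] algebra_simps)
        ultimately have "0 \<le> C * (c * (a * c)) * (q s + \<theta> s * r s) - (m * (a * c) + a) * q s + a * r s
            + m * ((k - 1) * (c * (a * c))) * r s + (m * (a * c) - a) * r s * \<theta> s + a * \<theta> s * (\<beta> s * W s)"
          using W_ge by linarith
        then have "0 \<le> \<eta> s * (C * (c * (a * c)) * (q s + \<theta> s * r s) - (m * (a * c) + a) * q s + a * r s
            + m * ((k - 1) * (c * (a * c))) * r s + (m * (a * c) - a) * r s * \<theta> s + a * \<theta> s * (\<beta> s * W s))"
          using \<eta>[OF s(2)] by simp
        moreover have "0 \<le> (\<eta> s - \<eta> 1) * (\<beta> s * Q s)"
          using \<eta>[OF s(2)] \<beta>[OF s(2)] Q0[OF s(1)] by simp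
        moreover have "D s = \<eta> s * (C * (c * (a * c)) * (q s + \<theta> s * r s) - (m * (a * c) + a) * q s + a * r s
            + m * ((k - 1) * (c * (a * c))) * r s + (m * (a * c) - a) * r s * \<theta> s + a * \<theta> s * (\<beta> s * W s))
            + (\<eta> s - \<eta> 1) * (\<beta> s * Q s)"
        proof -
          have "c / s = c * (a * c)" "m / s = m * (a * c)" using ac by auto
          then show ?thesis
            unfolding D_def a_def[symmetric] c_def[symmetric] by (simp add: algebra_simps)
        qed
        ultimately show "0 \<le> D s" by linarith
      qed (use t in auto)
      moreover have "S 1 = A 1"
        by (simp add: S_def A1 q_def r_def \<theta>_def algebra_simps)
      ultimately show ?thesis by simp
    qed
    note AS = this
    have A0: "0 \<le> A t" if t: "t \<in> {1..T}" for t
    proof -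
      have "0 \<le> integral {1..t} (\<lambda>s. \<beta> s * Q s)"
      proof (rule integral_nonneg)
        show "(\<lambda>s. \<beta> s * Q s) integrable_on {1..t}"
          by (intro integrable_continuous_real continuous_on_subset[OF c\<beta>Q]) (use t in auto)
      qed (use \<beta> Q0 t in \<open>auto simp: less_imp_le\<close>)
      moreover have "0 \<le> \<beta> 1 * (w 1 + (1 + m) * F 1)"
        using \<beta>[of 1] w1 F1 m by simp
      ultimately show ?thesis
        using \<eta>(3)[of 1] by (simp add: A_def)
    qed
    have "\<delta> * A t \<le> q t" if t: "t \<in> {1..T}" for t
    proof -
      define E where "E t = exp (K * \<phi>k k t)" for t
      define X where "X t = K * t powr (- k) * (q t - \<delta> * A t)
        + (- (m / t + t powr (- k)) * q t + t powr (- k) * r t + \<beta> t * Q t - \<delta> * (\<eta> 1 * (\<beta> t * Q t)))" for t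
      have "E 1 * (q 1 - \<delta> * A 1) \<le> E t * (q t - \<delta> * A t)"
      proof (rule nondecreasing_within[of 1 T "\<lambda>t. E t * (q t - \<delta> * A t)" "\<lambda>t. E t * X t"])
        fix s assume s: "s \<in> {1..T}"
        have "((\<lambda>t. E t * (q t - \<delta> * A t)) has_real_derivative
            E s * (K * s powr (- k)) * (q s - \<delta> * A s)
            + (- (m / s + s powr (- k)) * q s + s powr (- k) * r s + \<beta> s * Q s - \<delta> * (\<eta> 1 * (\<beta> s * Q s))) * E s)
            (at s within {1..T})"
          unfolding E_def using s k
          by (intro DERIV_mult DERIV_diff DERIV_cmult dq dA DERIV_chain2[OF DERIV_exp] \<phi>k_has_real_derivative) auto
        then show "((\<lambda>t. E t * (q t - \<delta> * A t)) has_real_derivative E s * X s) (at s within {1..T})"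
          by (simp add: X_def algebra_simps)
      next
        fix s assume "1 < s" "s < t"
        then have s: "s \<in> {1..T}" "1 \<le> s" using t by auto
        define a where "a = s powr (- k)"
        have a0: "0 < a" and au: "1 / s \<le> a"
          using s k powr_mono[of "- 1" "- k" s] by (auto simp: a_def powr_minus_divide)
        have "\<eta> s * (q s + \<theta> s * r s) \<le> q s + \<theta> s * r s"
          using \<eta>[OF s(2)] qr[OF s(1)] \<theta>[OF s(2)] by (intro mult_left_le_one_le) auto
        then have "A s \<le> q s + \<theta> s * r s" using AS[OF s(1)] by (simp add: S_def)
        then have "A s / \<theta> s \<le> q s / \<theta> s + r s"
          using \<theta>[OF s(2)] by (simp add: field_simps)
        moreover have "A s * k0 \<le> A s / \<theta> s"
          using A0[OF s(1)] \<theta>[OF s(2)] unfolding k0_def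
          by (simp add: divide_left_mono)
        moreover have "q s / \<theta> s \<le> 2 * q s"
          using \<theta>[OF s(2)] qr[OF s(1)] by (simp add: field_simps)
        ultimately have "a * (A s * k0 - 2 * q s) \<le> a * r s"
          using a0 by (intro mult_left_mono) auto
        moreover have "m / s * q s \<le> \<bar>m\<bar> * a * q s"
        proof (rule mult_right_mono)
          have "m * (1 / s) \<le> \<bar>m\<bar> * a" using au s by (intro mult_mono) auto
          then show "m / s \<le> \<bar>m\<bar> * a" by simp
        qed (use qr[OF s(1)] in simp)
        moreover have "0 \<le> a * A s * (k0 - K * \<delta>)"
        proof -
          have "K * \<delta> \<le> k0" using \<delta>(2) by (simp add: K_def field_simps)
          then show ?thesis using a0 A0[OF s(1)] by simp
        qed
        moreover have "0 \<le> (1 - \<delta> * \<eta> 1) * (\<beta> s * Q s)"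
          using \<delta> \<eta>[of 1] \<beta>[OF s(2)] Q0[OF s(1)] mult_mono[of \<delta> 1 "\<eta> 1" 1] by simp
        moreover have "X s = K * a * q s - a * q s - m / s * q s + a * r s - K * \<delta> * a * A s
            + (1 - \<delta> * \<eta> 1) * (\<beta> s * Q s)"
          by (simp add: X_def a_def algebra_simps)
        moreover have "K * a * q s = \<bar>m\<bar> * a * q s + 3 * a * q s"
          by (simp add: K_def algebra_simps)
        ultimately have "0 \<le> X s" by (simp add: algebra_simps)
        then show "0 \<le> E s * X s" by (simp add: E_def)
      qed (use t in auto)
      moreover have "\<delta> * A 1 \<le> q 1"
      proof -
        have "\<delta> * A 1 = \<eta> 1 * (\<beta> 1 * (\<delta> * (w 1 + (1 + m) * F 1)))"
          by (simp add: A1)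
        also have "\<dots> \<le> \<eta> 1 * (\<beta> 1 * w 1)"
          using \<eta>(3)[of 1] \<beta>[of 1] \<delta>(3) by (intro mult_left_mono) auto
        also have "\<dots> \<le> q 1"
          using \<eta>[of 1] \<beta>[of 1] w1 by (simp add: q_def mult_left_le_one_le)
        finally show ?thesis .
      qed
      ultimately have "0 \<le> E t * (q t - \<delta> * A t)"
        using mult_nonneg_nonneg[of "E 1" "q 1 - \<delta> * A 1"] unfolding E_def by (smt (verit) exp_ge_zero)
      then show ?thesis by (simp add: E_def zero_le_mult_iff)
    qed
    from this[OF t] show ?thesis by (simp add: q_def A_def)
  qed
  show thesis
  proof (rule that[of "1 + m" "\<eta> 1" "min 1 (k0 / K)"])
    show "0 < 1 + m" "0 < \<eta> 1" "0 < min 1 (k0 / K)"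
      using m \<eta>[of 1] by (auto simp: k0_def K_def)
  qed (rule main[unfolded \<beta>_def])
qed

section \<open>Blow-up of the averaged problem\<close>

text \<open>What averaging leaves of the wave equation. The increasing function \<open>M\<close> is the accumulated excess of
  the true nonlinear term over its Jensen lower bound. This excess is merely integrable in time, so \<open>M\<close>
  need not be differentiable, and its monotonicity is what is recorded.\<close>

definition averaged_system ::
    "real \<Rightarrow> real \<Rightarrow> real \<Rightarrow> real \<Rightarrow> real \<Rightarrow> real \<Rightarrow> (real \<Rightarrow> real) \<Rightarrow> (real \<Rightarrow> real) \<Rightarrow> bool"
  where "averaged_system k \<mu> p a c T F W \<longleftrightarrow> continuous_on {1..T} W \<and>
    (\<forall>t\<in>{1..T}. (F has_real_derivative W t) (at t within {1..T})) \<and>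
    (\<exists>M. mono_on {1..T} M \<and> M 1 = 0 \<and>
      (\<forall>t\<in>{1..T}. W t = W 1 + integral {1..t} (\<lambda>s. s powr (- 2 * k) * F s - \<mu> / s * W s
         + c * s powr (- (a * (p - 1))) * exp (- ((p - 1) * \<phi>k k s)) * \<bar>W s\<bar> powr p) + M t))"

lemma continuous_on_forcing:
  fixes W :: "real \<Rightarrow> real"
  assumes k: "k < 1" and p: "1 < p" and W: "continuous_on {1..T} W"
  shows "continuous_on {1..T} (\<lambda>s. c * s powr b * exp (- ((p - 1) * \<phi>k k s)) * \<bar>W s\<bar> powr p)"
proof (intro continuous_on_mult continuous_on_const)
  show "continuous_on {1..T} (\<lambda>s. s powr b)"
    by (rule continuous_on_powr[OF continuous_on_id continuous_on_const]) auto
  have "continuous_on {1..T} (\<phi>k k)"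
    using k by (intro DERIV_continuous_on[OF \<phi>k_has_real_derivative]) auto
  then show "continuous_on {1..T} (\<lambda>s. exp (- ((p - 1) * \<phi>k k s)))"
    by (rule continuous_on_exp[OF continuous_on_minus[OF continuous_on_mult[OF continuous_on_const]]])
  show "continuous_on {1..T} (\<lambda>s. \<bar>W s\<bar> powr p)"
    by (rule continuous_on_powr'[OF continuous_on_rabs[OF W] continuous_on_const]) (use p in auto)
qed

text \<open>The accumulated forcing \<open>A\<close> satisfies \<open>A' \<ge> c' t powr (- \<Lambda>) A\<^sup>p\<close>, so
  \<open>- A powr (1 - p) - (p - 1) c' \<integral>\<^sub>1\<^sup>t s powr (- \<Lambda>) ds\<close> is increasing; comparing its values at \<open>1\<close> and \<open>T\<close>
  gives the bound. The power of \<open>\<epsilon>\<close> is that of \<open>A 1 powr (1 - p)\<close>, as \<open>A 1\<close> is proportional to \<open>\<epsilon>\<close>.\<close>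

lemma blow_up_time_bound:
  fixes k \<mu> p a c f\<^sub>0 g\<^sub>0 :: real
  assumes k: "0 \<le> k" "k < 1" and \<mu>: "0 < \<mu>" and p: "1 < p" and c: "0 < c"
    and data: "0 < f\<^sub>0" "0 < g\<^sub>0"
  obtains B where "0 < B" and
    "\<And>\<epsilon> T F W. \<lbrakk>0 < \<epsilon>; 1 \<le> T; averaged_system k \<mu> p a c T F W; F 1 = \<epsilon> * f\<^sub>0; W 1 = \<epsilon> * g\<^sub>0\<rbrakk>
      \<Longrightarrow> integral {1..T} (\<lambda>t. t powr (- ((a + (k + \<mu>) / 2) * (p - 1)))) \<le> B * \<epsilon> powr (- (p - 1))"
proof -
  define \<beta> where "\<beta> = amp k \<mu>"
  define \<Lambda> where "\<Lambda> = (a + (k + \<mu>) / 2) * (p - 1)"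
  obtain K\<^sub>0 \<eta> \<delta>\<^sub>0 where K\<^sub>0: "0 < K\<^sub>0" and \<eta>: "0 < \<eta>" and \<delta>\<^sub>0: "0 < \<delta>\<^sub>0" and lower:
    "\<And>T F W w Q \<delta> t. \<lbrakk>minorant_system k \<mu> T F W w Q; 0 < \<delta>; \<delta> \<le> \<delta>\<^sub>0;
      \<delta> * (w 1 + K\<^sub>0 * F 1) \<le> w 1; t \<in> {1..T}\<rbrakk> \<Longrightarrow>
      \<delta> * (\<eta> * (\<beta> 1 * (w 1 + K\<^sub>0 * F 1) + integral {1..t} (\<lambda>s. \<beta> s * Q s))) \<le> \<beta> t * w t"
    using outgoing_wave_lower_bound[OF k \<mu>, folded \<beta>_def] by blast
  define \<delta> where "\<delta> = min \<delta>\<^sub>0 (g\<^sub>0 / (g\<^sub>0 + K\<^sub>0 * f\<^sub>0))"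
  define \<kappa> where "\<kappa> = \<eta> * (\<beta> 1 * (g\<^sub>0 + K\<^sub>0 * f\<^sub>0))"
  define c' where "c' = \<eta> * c * \<delta> powr p"
  have I0: "0 < g\<^sub>0 + K\<^sub>0 * f\<^sub>0" using data K\<^sub>0 by (intro add_pos_pos mult_pos_pos)
  have \<delta>: "0 < \<delta>" "\<delta> \<le> \<delta>\<^sub>0" "\<delta> * (g\<^sub>0 + K\<^sub>0 * f\<^sub>0) \<le> g\<^sub>0"
  proof -
    show "0 < \<delta>" "\<delta> \<le> \<delta>\<^sub>0" using I0 \<delta>\<^sub>0 data by (simp_all add: \<delta>_def)
    have "\<delta> \<le> g\<^sub>0 / (g\<^sub>0 + K\<^sub>0 * f\<^sub>0)" by (simp add: \<delta>_def)
    then show "\<delta> * (g\<^sub>0 + K\<^sub>0 * f\<^sub>0) \<le> g\<^sub>0" using I0 by (simp add: pos_le_divide_eq)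
  qed
  have \<kappa>: "0 < \<kappa>" using \<eta> I0 amp_pos[of 1 k \<mu>] by (simp add: \<kappa>_def \<beta>_def)
  have c': "0 < c'" using \<eta> c \<delta> by (simp add: c'_def)
  have main: "integral {1..T} (\<lambda>t. t powr (- \<Lambda>)) \<le> \<kappa> powr (1 - p) / ((p - 1) * c') * \<epsilon> powr (- (p - 1))"
    if \<epsilon>: "0 < \<epsilon>" and T: "1 \<le> T" and sys: "averaged_system k \<mu> p a c T F W"
      and init: "F 1 = \<epsilon> * f\<^sub>0" "W 1 = \<epsilon> * g\<^sub>0"
    for \<epsilon> T F W
  proof -
    have cW: "continuous_on {1..T} W"
      and dF: "\<And>t. t \<in> {1..T} \<Longrightarrow> (F has_real_derivative W t) (at t within {1..T})"
      using sys by (simp_all add: averaged_system_def)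
    define Q where "Q s = c * s powr (- (a * (p - 1))) * exp (- ((p - 1) * \<phi>k k s)) * \<bar>W s\<bar> powr p" for s
    have cQ: "continuous_on {1..T} Q"
      unfolding Q_def[abs_def] by (rule continuous_on_forcing[OF k(2) p cW])
    have Q0: "0 \<le> Q t" for t using c by (simp add: Q_def)
    obtain M where M: "mono_on {1..T} M" "M 1 = 0"
      and eq: "\<And>t. t \<in> {1..T} \<Longrightarrow>
        W t = W 1 + integral {1..t} (\<lambda>s. s powr (- 2 * k) * F s - \<mu> / s * W s + Q s) + M t"
      using sys unfolding averaged_system_def Q_def by blast
    have pos: "0 < F 1" "0 < W 1" using init \<epsilon> data by auto
    obtain w where w1: "w 1 = W 1" and Fpos: "\<And>t. t \<in> {1..T} \<Longrightarrow> 0 < F t"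
      and wpos: "\<And>t. t \<in> {1..T} \<Longrightarrow> 0 < w t" and wW: "\<And>t. t \<in> {1..T} \<Longrightarrow> w t \<le> W t"
      and dw: "\<And>t. t \<in> {1..T} \<Longrightarrow> (w has_real_derivative
        t powr (- 2 * k) * F t - \<mu> / t * w t + Q t) (at t within {1..T})"
      using positivity_and_smooth_minorant[OF \<mu> T dF cW cQ Q0 M eq pos] by blast
    define A where "A t = \<eta> * (\<beta> 1 * (w 1 + K\<^sub>0 * F 1) + integral {1..t} (\<lambda>s. \<beta> s * Q s))" for t
    have "w 1 + K\<^sub>0 * F 1 = \<epsilon> * (g\<^sub>0 + K\<^sub>0 * f\<^sub>0)"
      by (simp add: w1 init algebra_simps)
    then have \<delta>w: "\<delta> * (w 1 + K\<^sub>0 * F 1) \<le> w 1"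
      using mult_left_mono[OF \<delta>(3), of \<epsilon>] \<epsilon> by (simp only: w1 init mult.left_commute less_imp_le)
    have "minorant_system k \<mu> T F W w Q"
      using cQ Fpos wpos wW Q0 dF dw by (simp add: minorant_system_def)
    from lower[OF this \<delta>(1,2) \<delta>w]
    have q_ge: "\<delta> * A t \<le> \<beta> t * w t" if "t \<in> {1..T}" for t
      using that by (simp add: A_def)
    have \<beta>: "0 < \<beta> t" if "1 \<le> t" for t using that by (simp add: \<beta>_def amp_pos)
    have c\<beta>Q: "continuous_on {1..T} (\<lambda>s. \<beta> s * Q s)"
      by (intro continuous_on_mult cQ DERIV_continuous_on[of _ \<beta>])
        (use k in \<open>auto simp: \<beta>_def intro!: amp_has_real_derivative\<close>)
    have dA: "(A has_real_derivative \<eta> * (\<beta> t * Q t)) (at t within {1..T})" if "t \<in> {1..T}" for t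
      unfolding A_def[abs_def] using that
      by (auto intro!: derivative_eq_intros integral_has_real_derivative[OF c\<beta>Q])
    have A1: "A 1 = \<kappa> * \<epsilon>" by (simp add: A_def \<kappa>_def w1 init algebra_simps)
    have Apos: "0 < A t" if t: "t \<in> {1..T}" for t
    proof -
      have "A 1 \<le> A t"
        by (rule nondecreasing_within[OF dA]) (use t \<eta> \<beta> Q0 T in \<open>auto simp: less_imp_le\<close>)
      then show ?thesis using A1 \<kappa> \<epsilon> by (smt (verit) mult_pos_pos)
    qed
    have A'_ge: "c' * t powr (- \<Lambda>) * A t powr p \<le> \<eta> * (\<beta> t * Q t)" if t: "t \<in> {1..T}" for t
    proof -
      have t0: "0 < t" "1 \<le> t" using t by auto
      have "(\<delta> * A t) powr p \<le> (\<beta> t * W t) powr p"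
      proof (rule powr_mono2)
        have "\<beta> t * w t \<le> \<beta> t * W t" using wW[OF t] \<beta>[OF t0(2)] by simp
        then show "\<delta> * A t \<le> \<beta> t * W t" using q_ge[OF t] by linarith
      qed (use p \<delta> Apos[OF t] in auto)
      also have "\<dots> = \<beta> t powr p * \<bar>W t\<bar> powr p"
        using \<beta>[OF t0(2)] wpos[OF t] wW[OF t] by (simp add: powr_mult)
      finally have *: "\<delta> powr p * A t powr p \<le> \<beta> t powr p * \<bar>W t\<bar> powr p"
        using \<delta> Apos[OF t] by (simp add: powr_mult)
      have "\<beta> t powr (p - 1) = t powr ((k + \<mu>) / 2 * (p - 1)) * exp (- ((p - 1) * \<phi>k k t))"
        using t0 by (simp add: \<beta>_def amp_def powr_mult powr_powr exp_powr_real mult.commute)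
      then have "t powr (- \<Lambda>) * \<beta> t powr (p - 1)
          = t powr (- (a * (p - 1))) * exp (- ((p - 1) * \<phi>k k t))"
        using t0 by (simp add: \<Lambda>_def algebra_simps flip: powr_add)
      moreover have "\<beta> t powr p = \<beta> t * \<beta> t powr (p - 1)"
        using \<beta>[OF t0(2)] by (simp add: powr_diff)
      ultimately have **: "t powr (- \<Lambda>) * \<beta> t powr p
          = \<beta> t * (t powr (- (a * (p - 1))) * exp (- ((p - 1) * \<phi>k k t)))"
        by (simp add: mult.left_commute)
      have "c' * t powr (- \<Lambda>) * A t powr p = \<eta> * c * t powr (- \<Lambda>) * (\<delta> powr p * A t powr p)"
        by (simp add: c'_def)
      also have "\<dots> \<le> \<eta> * c * t powr (- \<Lambda>) * (\<beta> t powr p * \<bar>W t\<bar> powr p)"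
        using \<eta> c * by (intro mult_left_mono) auto
      also have "\<dots> = \<eta> * c * (t powr (- \<Lambda>) * \<beta> t powr p) * \<bar>W t\<bar> powr p" by simp
      also have "\<dots> = \<eta> * (\<beta> t * Q t)"
        unfolding ** by (simp add: Q_def)
      finally show ?thesis .
    qed
    define H where "H t = - (A t powr (1 - p)) - (p - 1) * c' * integral {1..t} (\<lambda>t. t powr (- \<Lambda>))" for t
    have "H 1 \<le> H T"
    proof (rule nondecreasing_within[of 1 T H])
      fix t assume t: "t \<in> {1..T}"
      have "((\<lambda>t. A t powr (1 - p)) has_real_derivative (1 - p) * (A t powr (1 - p) / A t) * (\<eta> * (\<beta> t * Q t)))
          (at t within {1..T})"
        by (rule DERIV_chain2[OF powr_has_real_derivative_within dA[OF t]]) (rule Apos[OF t])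
      moreover have "continuous_on {1..T} (\<lambda>t. t powr (- \<Lambda>))"
        by (intro continuous_intros) auto
      ultimately show "(H has_real_derivative
          - ((1 - p) * (A t powr (1 - p) / A t) * (\<eta> * (\<beta> t * Q t))) - (p - 1) * c' * t powr (- \<Lambda>)) (at t within {1..T})"
        unfolding H_def[abs_def] using t
        by (intro DERIV_diff DERIV_minus DERIV_cmult integral_has_real_derivative) auto
    next
      fix t assume "1 < t" "t < T"
      then have t: "t \<in> {1..T}" by auto
      have "c' * t powr (- \<Lambda>) = A t powr (- p) * (c' * t powr (- \<Lambda>) * A t powr p)"
        using Apos[OF t] by (simp add: powr_minus field_simps)
      also have "\<dots> \<le> A t powr (- p) * (\<eta> * (\<beta> t * Q t))"
        by (intro mult_left_mono A'_ge t) auto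
      finally have "(p - 1) * (c' * t powr (- \<Lambda>)) \<le> (p - 1) * (A t powr (- p) * (\<eta> * (\<beta> t * Q t)))"
        using p by (intro mult_left_mono) auto
      moreover have "A t powr (1 - p) / A t = A t powr (- p)"
        using Apos[OF t] by (simp add: powr_diff powr_minus_divide)
      ultimately show "0 \<le> - ((1 - p) * (A t powr (1 - p) / A t) * (\<eta> * (\<beta> t * Q t))) - (p - 1) * c' * t powr (- \<Lambda>)"
        by (simp add: algebra_simps)
    qed (use T in auto)
    moreover have "H 1 = - ((\<kappa> * \<epsilon>) powr (1 - p))" by (simp add: H_def A1)
    moreover have "H T \<le> - ((p - 1) * c' * integral {1..T} (\<lambda>t. t powr (- \<Lambda>)))"
      by (simp add: H_def)
    ultimately have "(p - 1) * c' * integral {1..T} (\<lambda>t. t powr (- \<Lambda>)) \<le> (\<kappa> * \<epsilon>) powr (1 - p)"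
      by linarith
    then have "integral {1..T} (\<lambda>t. t powr (- \<Lambda>)) \<le> (\<kappa> * \<epsilon>) powr (1 - p) / ((p - 1) * c')"
      using p c' by (simp add: pos_le_divide_eq mult.commute)
    then show ?thesis using \<kappa> \<epsilon> by (simp add: powr_mult)
  qed
  show thesis
  proof (rule that)
    show "0 < \<kappa> powr (1 - p) / ((p - 1) * c')" using \<kappa> p c' by simp
  qed (rule main[unfolded \<Lambda>_def])
qed

text \<open>For \<open>\<epsilon> \<le> 1\<close> the right-hand side is at least a constant, which absorbs the contribution of the lower
  limit of integration.\<close>

lemma subcritical_integral_bound:
  fixes \<Lambda> B p T \<epsilon> :: real
  assumes "\<Lambda> < 1" "0 < B" "1 < p" "0 < \<epsilon>" "\<epsilon> \<le> 1" "1 \<le> T"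
    and "integral {1..T} (\<lambda>t. t powr (- \<Lambda>)) \<le> B * \<epsilon> powr (- (p - 1))"
  shows "T \<le> (1 + (1 - \<Lambda>) * B) powr (1 / (1 - \<Lambda>)) * \<epsilon> powr (- ((p - 1) / (1 - \<Lambda>)))"
proof -
  have "((\<lambda>t. t powr (- \<Lambda>)) has_integral (T powr (1 - \<Lambda>) / (1 - \<Lambda>) - 1 powr (1 - \<Lambda>) / (1 - \<Lambda>))) {1..T}"
  proof (rule fundamental_theorem_of_calculus)
    fix t assume t: "t \<in> {1..T}"
    have "((\<lambda>t. t powr (1 - \<Lambda>) / (1 - \<Lambda>)) has_real_derivative (1 - \<Lambda>) * (t powr (1 - \<Lambda>) / t) / (1 - \<Lambda>)) (at t within {1..T})"
      by (intro DERIV_cdivide powr_has_real_derivative_within) (use t in auto)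
    moreover have "(1 - \<Lambda>) * (t powr (1 - \<Lambda>) / t) / (1 - \<Lambda>) = t powr (- \<Lambda>)"
      using t assms(1) by (simp add: powr_diff powr_minus_divide)
    ultimately show "((\<lambda>t. t powr (1 - \<Lambda>) / (1 - \<Lambda>)) has_vector_derivative t powr (- \<Lambda>)) (at t within {1..T})"
      by (simp add: has_real_derivative_iff_has_vector_derivative)
  qed (rule assms(6))
  then have "(T powr (1 - \<Lambda>) - 1) / (1 - \<Lambda>) \<le> B * \<epsilon> powr (- (p - 1))"
    using assms(7) by (simp add: integral_unique diff_divide_distrib)
  then have "T powr (1 - \<Lambda>) \<le> 1 + (1 - \<Lambda>) * B * \<epsilon> powr (- (p - 1))"
    using assms(1) by (simp add: pos_divide_le_eq algebra_simps)
  moreover have "1 \<le> \<epsilon> powr (- (p - 1))"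
    using powr_mono'[of "- (p - 1)" 0 \<epsilon>] assms by simp
  moreover have "(1 + (1 - \<Lambda>) * B) * \<epsilon> powr (- (p - 1))
      = \<epsilon> powr (- (p - 1)) + (1 - \<Lambda>) * B * \<epsilon> powr (- (p - 1))"
    by (simp only: distrib_right mult_1)
  ultimately have "T powr (1 - \<Lambda>) \<le> (1 + (1 - \<Lambda>) * B) * \<epsilon> powr (- (p - 1))"
    by linarith
  then have "(T powr (1 - \<Lambda>)) powr (1 / (1 - \<Lambda>)) \<le> ((1 + (1 - \<Lambda>) * B) * \<epsilon> powr (- (p - 1))) powr (1 / (1 - \<Lambda>))"
    using assms by (intro powr_mono2) auto
  moreover have "(T powr (1 - \<Lambda>)) powr (1 / (1 - \<Lambda>)) = T"
    using assms by (simp add: powr_powr)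
  ultimately show ?thesis
    using assms by (simp add: powr_mult powr_powr minus_divide_left)
qed

lemma critical_integral_bound:
  fixes B p T \<epsilon> :: real
  assumes "1 \<le> T" and "integral {1..T} (\<lambda>t. t powr (- 1)) \<le> B * \<epsilon> powr (- (p - 1))"
  shows "T \<le> exp (B * \<epsilon> powr (- (p - 1)))"
proof -
  have "((\<lambda>t. t powr (- 1)) has_integral (ln T - ln 1)) {1..T}"
  proof (rule fundamental_theorem_of_calculus)
    fix t assume "t \<in> {1..T}"
    then have "(ln has_real_derivative t powr (- 1)) (at t within {1..T})"
      by (auto intro!: derivative_eq_intros simp: powr_minus_divide)
    then show "(ln has_vector_derivative t powr (- 1)) (at t within {1..T})"
      by (simp add: has_real_derivative_iff_has_vector_derivative)
  qed (rule assms(1))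
  then have "ln T \<le> B * \<epsilon> powr (- (p - 1))"
    using assms(2) by (simp add: integral_unique)
  then have "exp (ln T) \<le> exp (B * \<epsilon> powr (- (p - 1)))" by simp
  then show ?thesis using assms(1) by simp
qed

section \<open>Averages of energy solutions\<close>

text \<open>The tangent at \<open>l\<close> of the convex function \<open>y powr p\<close>. Integrating it and then choosing \<open>l\<close> optimally
  proves Jensen's inequality in the following form, where the total weight need only be
  bounded from above.\<close>

lemma powr_tangent:
  fixes y l p :: real
  assumes "0 \<le> y" "0 < l" "1 < p"
  shows "p * l powr (p - 1) * y - (p - 1) * l powr p \<le> y powr p"
proof (cases "y = 0")
  case True
  then show ?thesis using assms by simp
next
  case False
  then have y: "0 < y" using assms by simp
  have conv: "convex_on {0<..} (\<lambda>x::real. x powr p)" by (rule powr_convex) (use assms in simp)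
  have "y powr p - l powr p \<ge> p * l powr (p - 1) * (y - l)"
  proof (rule convex_on_imp_above_tangent[OF conv])
    show "((\<lambda>x. x powr p) has_real_derivative p * l powr (p - 1)) (at l within {0<..})"
      using assms by (auto intro!: derivative_eq_intros)
  qed (use y assms in \<open>auto simp: interior_open\<close>)
  moreover have "p * l powr (p - 1) * (y - l) = p * l powr (p - 1) * y - p * l powr p"
    using assms by (simp add: right_diff_distrib powr_diff)
  ultimately show ?thesis by (simp add: left_diff_distrib)
qed

lemma Jensen_weighted_power:
  fixes h w :: "'a \<Rightarrow> real"
  assumes p: "1 < p" and w: "\<And>x. 0 \<le> w x"
    and int: "integrable M w" "integrable M (\<lambda>x. h x * w x)" "integrable M (\<lambda>x. \<bar>h x\<bar> powr p * w x)"
    and I: "(LINT x|M. w x) \<le> I" "0 < I"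
  shows "I powr (1 - p) * \<bar>LINT x|M. h x * w x\<bar> powr p \<le> (LINT x|M. \<bar>h x\<bar> powr p * w x)"
proof -
  define V where "V = \<bar>LINT x|M. h x * w x\<bar>"
  show ?thesis
  proof (cases "V = 0")
    case True
    have "0 \<le> (LINT x|M. \<bar>h x\<bar> powr p * w x)"
      by (intro Bochner_Integration.integral_nonneg mult_nonneg_nonneg w) auto
    then show ?thesis using True p unfolding V_def[symmetric] by simp
  next
    case False
    then have V: "0 < V" by (simp add: V_def)
    (* the optimal tangent point: the absolute weighted mean of h, with the total weight replaced by I *)
    define l where "l = V / I"
    have l: "0 < l" using V I by (simp add: l_def)
    have int': "integrable M (\<lambda>x. \<bar>h x\<bar> * w x)"
      using integrable_abs[OF int(2)] by (simp add: abs_mult w)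
    have "V \<le> (LINT x|M. \<bar>h x\<bar> * w x)"
      using integral_abs_bound[of M "\<lambda>x. h x * w x"] by (simp add: V_def abs_mult w)
    then have "p * l powr (p - 1) * V \<le> p * l powr (p - 1) * (LINT x|M. \<bar>h x\<bar> * w x)"
      using p by (intro mult_left_mono) auto
    moreover have "(p - 1) * l powr p * (LINT x|M. w x) \<le> (p - 1) * l powr p * I"
      using p I by (intro mult_left_mono) auto
    moreover have "p * l powr (p - 1) * (LINT x|M. \<bar>h x\<bar> * w x) - (p - 1) * l powr p * (LINT x|M. w x)
        = (LINT x|M. p * l powr (p - 1) * (\<bar>h x\<bar> * w x) - (p - 1) * l powr p * w x)"
      using int int' by simp
    moreover have "\<dots> \<le> (LINT x|M. \<bar>h x\<bar> powr p * w x)"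
    proof (rule integral_mono)
      show "p * l powr (p - 1) * (\<bar>h x\<bar> * w x) - (p - 1) * l powr p * w x \<le> \<bar>h x\<bar> powr p * w x" for x
        using mult_right_mono[OF powr_tangent[OF _ l p, of "\<bar>h x\<bar>"] w[of x]]
        by (simp add: algebra_simps)
    qed (use int int' in auto)
    moreover have "p * l powr (p - 1) * V - (p - 1) * l powr p * I = I powr (1 - p) * V powr p"
    proof -
      have "l powr p * I = I powr (1 - p) * V powr p"
        using V I by (simp add: l_def powr_divide powr_diff)
      moreover have "l powr (p - 1) * V = l powr p * I"
        using V I by (simp add: l_def powr_divide powr_diff)
      ultimately show ?thesis by (simp add: algebra_simps)
    qed
    ultimately show ?thesis unfolding V_def by linarith
  qed
qed

text \<open>Integration by parts: the weak gradient is tested with each partial derivative of \<open>\<psi>\<close>.\<close>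

lemma weak_laplacian:
  fixes h :: "'a::euclidean_space \<Rightarrow> real"
  assumes h: "H1 h" and \<psi>: "test_function UNIV \<psi>"
  shows "(LINT x|lborel. wgrad h x \<bullet> (\<Sum>b\<in>Basis. frechet_derivative \<psi> (at x) b *\<^sub>R b))
    = - (LINT x|lborel. h x * (\<Sum>b\<in>Basis. frechet_derivative (\<lambda>y. frechet_derivative \<psi> (at y) b) (at x) b))"
proof -
  define G where "G = wgrad h"
  have "L2 G \<and> weak_gradient h G"
    unfolding G_def wgrad_def
    by (rule someI_ex[of "\<lambda>G. L2 G \<and> weak_gradient h G"]) (use h in \<open>simp add: H1_def\<close>)
  then have G: "L2 G" "weak_gradient h G" by auto
  have Lh: "L2 h" using h by (simp add: H1_def)
  note d1 = test_function_derivative[OF \<psi>]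
  have "(LINT x|lborel. G x \<bullet> (\<Sum>b\<in>Basis. frechet_derivative \<psi> (at x) b *\<^sub>R b))
      = (LINT x|lborel. (\<Sum>b\<in>Basis. (G x \<bullet> b) * frechet_derivative \<psi> (at x) b))"
    by (simp add: inner_sum_right mult.commute)
  also have "\<dots> = (\<Sum>b\<in>Basis. LINT x|lborel. (G x \<bullet> b) * frechet_derivative \<psi> (at x) b)"
    by (intro Bochner_Integration.integral_sum L2_mult_integrable L2_component G(1) test_function_L2[OF d1])
  also have "\<dots> = (\<Sum>b\<in>Basis. - (LINT x|lborel. h x * frechet_derivative (\<lambda>y. frechet_derivative \<psi> (at y) b) (at x) b))"
  proof (rule sum.cong)
    fix b :: 'a assume b: "b \<in> Basis"
    show "(LINT x|lborel. (G x \<bullet> b) * frechet_derivative \<psi> (at x) b)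
        = - (LINT x|lborel. h x * frechet_derivative (\<lambda>y. frechet_derivative \<psi> (at y) b) (at x) b)"
      using G(2) d1[OF b] b unfolding weak_gradient_def by simp
  qed simp
  also have "\<dots> = - (LINT x|lborel. (\<Sum>b\<in>Basis. h x * frechet_derivative (\<lambda>y. frechet_derivative \<psi> (at y) b) (at x) b))"
    unfolding sum_negf
    by (subst Bochner_Integration.integral_sum)
      (auto intro!: L2_mult_integrable Lh test_function_L2[OF test_function_derivative[OF d1]])
  finally show ?thesis by (simp only: G_def sum_distrib_left)
qed

text \<open>For \<open>t \<ge> 1\<close> the radius \<open>\<phi>k k t + R\<close> is comparable to \<open>t powr (1 - k)\<close>.\<close>

lemma exponential_cone_integral:
  fixes e :: "'a::euclidean_space"
  assumes e: "e \<in> Basis" and k: "0 \<le> k" "k < 1" and R: "0 < R"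
  obtains C where "0 < C" and
    "\<And>t. 1 \<le> t \<Longrightarrow> (LINT x:cball 0 (\<phi>k k t + R)|lborel. exp (x \<bullet> e))
      \<le> C * t powr ((1 - k) * (real DIM('a) - 1) / 2) * exp (\<phi>k k t)"
proof -
  obtain C\<^sub>0 where C\<^sub>0: "0 < C\<^sub>0" and ball: "\<And>r. 0 \<le> r \<Longrightarrow>
      (LINT x:cball 0 r|lborel. exp (x \<bullet> e)) \<le> C\<^sub>0 * sqrt r ^ (DIM('a) - 1) * exp r"
    using exponential_ball_integral[OF e] by blast
  define n where "n = DIM('a) - 1"
  have n: "real n = real DIM('a) - 1" using DIM_positive[where 'a = 'a] by (simp add: n_def of_nat_diff)
  define D where "D = 1 / (1 - k) + R"
  have D: "0 < D" using k R by (simp add: D_def add_pos_pos)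
  show thesis
  proof (rule that[of "C\<^sub>0 * sqrt D ^ n * exp R"])
    show "0 < C\<^sub>0 * sqrt D ^ n * exp R" using C\<^sub>0 D by simp
    fix t :: real assume t: "1 \<le> t"
    define r where "r = \<phi>k k t + R"
    have one: "1 \<le> t powr (1 - k)" using t k by (simp add: ge_one_powr_ge_zero)
    have r0: "0 \<le> r" using t k R by (simp add: r_def \<phi>k_def)
    have "R * 1 \<le> R * t powr (1 - k)" using R one by (intro mult_left_mono) auto
    then have "r \<le> D * t powr (1 - k)"
      by (simp add: r_def \<phi>k_def D_def algebra_simps)
    then have "sqrt r \<le> sqrt D * sqrt (t powr (1 - k))"
      by (simp flip: real_sqrt_mult)
    also have "sqrt (t powr (1 - k)) = t powr ((1 - k) / 2)"
      using t by (simp add: powr_half_sqrt[symmetric] powr_powr)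
    finally have "sqrt r ^ n \<le> (sqrt D * t powr ((1 - k) / 2)) ^ n"
      using r0 by (intro power_mono) auto
    also have "\<dots> = sqrt D ^ n * t powr ((1 - k) * (real DIM('a) - 1) / 2)"
      using t by (simp add: power_mult_distrib powr_power n[symmetric] algebra_simps)
    finally have "C\<^sub>0 * sqrt r ^ n * exp r
        \<le> C\<^sub>0 * (sqrt D ^ n * t powr ((1 - k) * (real DIM('a) - 1) / 2)) * exp r"
      using C\<^sub>0 by (intro mult_left_mono mult_right_mono) auto
    also have "\<dots> = C\<^sub>0 * sqrt D ^ n * exp R * t powr ((1 - k) * (real DIM('a) - 1) / 2) * exp (\<phi>k k t)"
      by (simp add: r_def exp_add)
    finally show "(LINT x:cball 0 (\<phi>k k t + R)|lborel. exp (x \<bullet> e))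
        \<le> C\<^sub>0 * sqrt D ^ n * exp R * t powr ((1 - k) * (real DIM('a) - 1) / 2) * exp (\<phi>k k t)"
      using ball[OF r0] by (simp add: r_def n_def)
  qed
qed

text \<open>Fubini's theorem, with time as the second variable.\<close>

lemma slice_integrable:
  fixes G :: "'a::euclidean_space \<Rightarrow> real \<Rightarrow> real"
  assumes "set_integrable lborel (UNIV \<times> {1..t}) (\<lambda>(x, s). G x s)"
  shows "AE s in lborel. s \<in> {1..t} \<longrightarrow> integrable lborel (\<lambda>x. G x s)"
    and "set_integrable lborel {1..t} (\<lambda>s. LINT x|lborel. G x s)"
proof -
  have "integrable (lborel \<Otimes>\<^sub>M lborel) (case_prod (\<lambda>x s. indicator {1..t} s * G x s))"
    using assms unfolding set_integrable_def lborel_prod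
    by (rule Bochner_Integration.integrable_cong[THEN iffD1, rotated -1]) (auto simp: indicator_def)
  note slices = lborel_pair.AE_integrable_snd[OF this] lborel_pair.integrable_snd[OF this]
  show "AE s in lborel. s \<in> {1..t} \<longrightarrow> integrable lborel (\<lambda>x. G x s)"
    using slices(1) by eventually_elim auto
  show "set_integrable lborel {1..t} (\<lambda>s. LINT x|lborel. G x s)"
    using slices(2) by (simp add: set_integrable_def)
qed

lemma set_integral_continuous_Icc:
  fixes h :: "real \<Rightarrow> real"
  assumes "continuous_on {a..b} h"
  shows "(LINT s:{a..b}|lborel. h s) = integral {a..b} h"
  by (rule set_borel_integral_eq_integral(2)[OF borel_integrable_atLeastAtMost'[OF assms]])

text \<open>The weak identity is tested with the exponential, cut off outside the light cone up to time
  \<open>T\<^sub>1\<close> and beyond \<open>T\<^sub>1\<close> in time; neither cut-off is seen by the solution on \<open>[1, T\<^sub>1]\<close>. The gradient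
  term becomes \<open>- F\<close> because the weight is an eigenfunction of the Laplacian. The constant \<open>C\<close> does not
  depend on \<open>T\<^sub>1\<close>, which is what makes the final bound uniform.\<close>

lemma energy_solution_averaged:
  fixes f g :: "'a::euclidean_space \<Rightarrow> real" and e :: 'a
  assumes e: "e \<in> Basis" and k: "0 \<le> k" "k < 1" and p: "1 < p" and R: "0 < R"
    and C: "0 < C" "\<And>t. 1 \<le> t \<Longrightarrow> (LINT x:cball 0 (\<phi>k k t + R)|lborel. exp (x \<bullet> e))
      \<le> C * t powr a * exp (\<phi>k k t)"
    and f: "L2 f" "ess_support f \<subseteq> ball 0 R" and g: "L2 g" "ess_support g \<subseteq> ball 0 R"
    and sol: "energy_solution k \<mu> p f g \<epsilon> T u"
    and supp: "curve_support T u \<subseteq> {(x, t). 1 \<le> t \<and> norm x \<le> \<phi>k k t + R}"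
    and T: "1 \<le> T\<^sub>1" "T\<^sub>1 < T"
  obtains F W where "averaged_system k \<mu> p a (C powr (1 - p)) T\<^sub>1 F W"
    and "F 1 = \<epsilon> * (LINT x|lborel. f x * exp (x \<bullet> e))"
    and "W 1 = \<epsilon> * (LINT x|lborel. g x * exp (x \<bullet> e))"
proof -
  obtain v where dv: "L2_time_derivative T u v" and cv: "C_L2 T v"
    and weak: "\<And>\<Phi> t. test_function (UNIV \<times> {..<T}) \<Phi> \<Longrightarrow> t \<in> {1..<T} \<Longrightarrow>
      set_integrable lborel (UNIV \<times> {1..t}) (\<lambda>(x, s). \<bar>v s x\<bar> powr p * \<Phi> (x, s)) \<and>
      (LINT x|lborel. v t x * \<Phi> (x, t))
      - \<epsilon> * (LINT x|lborel. g x * \<Phi> (x, 1))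
      - (LINT s:{1..t}|lborel. LINT x|lborel. v s x * dt \<Phi> x s)
      + (LINT s:{1..t}|lborel. s powr (- 2 * k) *
           (LINT x|lborel. wgrad (u s) x \<bullet> grad_x \<Phi> x s))
      + (LINT s:{1..t}|lborel. LINT x|lborel. \<mu> / s * v s x * \<Phi> (x, s))
      = (LINT s:{1..t}|lborel. LINT x|lborel. \<bar>v s x\<bar> powr p * \<Phi> (x, s))"
    using sol unfolding energy_solution_def by blast
  have H1u: "H1 (u t)" if "t \<in> {1..<T}" for t
    using sol that by (auto simp: energy_solution_def C_H1_def)
  have u1: "AE x in lborel. u 1 x = \<epsilon> * f x" using sol by (simp add: energy_solution_def)
  have L2u: "L2 (u t)" and L2v: "L2 (v t)" if "t \<in> {1..<T}" for t
    using dv that by (auto simp: L2_time_derivative_def)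
  have \<phi>_mono: "\<phi>k k s \<le> \<phi>k k t" if "1 \<le> s" "s \<le> t" for s t
    using that k by (auto simp: \<phi>k_def intro!: divide_right_mono powr_mono2)
  have \<phi>_pos: "0 < \<phi>k k t" if "1 \<le> t" for t
    using that k by (simp add: \<phi>k_def)
  (* the extra 1 puts the light cone up to time T1 inside the open ball on which
     the Laplacian of the cut-off exponential is known *)
  define r where "r = \<phi>k k T\<^sub>1 + R + 1"
  have r: "0 < r" "R \<le> r" using \<phi>_pos[OF T(1)] R by (auto simp: r_def)
  obtain \<psi> where \<psi>: "test_function UNIV \<psi>" and \<psi>0: "\<And>x. 0 \<le> \<psi> x"
    and \<psi>e: "\<And>x. norm x \<le> r \<Longrightarrow> \<psi> x = exp (x \<bullet> e)"
    and lap: "\<And>x. norm x < r \<Longrightarrow>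
      (\<Sum>b\<in>Basis. frechet_derivative (\<lambda>y. frechet_derivative \<psi> (at y) b) (at x) b) = \<psi> x"
    using truncated_exponential[OF e r(1)] by blast
  obtain \<Phi> where \<Phi>: "test_function (UNIV \<times> {..<T}) \<Phi>"
    and \<Phi>\<psi>: "\<And>x s. s \<in> {1..T\<^sub>1} \<Longrightarrow> \<Phi> (x, s) = \<psi> x"
    and dt\<Phi>: "\<And>x s. s \<in> {1..T\<^sub>1} \<Longrightarrow> dt \<Phi> x s = 0"
    and grad\<Phi>: "\<And>x s. s \<in> {1..T\<^sub>1} \<Longrightarrow> grad_x \<Phi> x s = (\<Sum>b\<in>Basis. frechet_derivative \<psi> (at x) b *\<^sub>R b)"
    using time_cutoff_test_function[OF \<psi> T] by blast
  have L2\<psi>: "L2 \<psi>" by (rule test_function_L2[OF \<psi>])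
  have sub: "t \<in> {1..<T}" if "t \<in> {1..T\<^sub>1}" for t using that T by auto
  have outside: "AE x in lborel. \<phi>k k t + R < norm x \<longrightarrow> u t x = 0 \<and> v t x = 0" if "t \<in> {1..T\<^sub>1}" for t
    by (rule support_AE[OF dv sub[OF that] supp])
  define F where "F t = (LINT x|lborel. u t x * \<psi> x)" for t
  define W where "W t = (LINT x|lborel. v t x * \<psi> x)" for t
  define P where "P t = (LINT x|lborel. \<bar>v t x\<bar> powr p * \<psi> x)" for t
  define Q where "Q s = C powr (1 - p) * s powr (- (a * (p - 1))) * exp (- ((p - 1) * \<phi>k k s)) * \<bar>W s\<bar> powr p" for s
  have subset: "{1..T\<^sub>1} \<subseteq> {1..<T}" using T by auto
  have dF: "(F has_real_derivative W t) (at t within {1..T\<^sub>1})" if "t \<in> {1..T\<^sub>1}" for t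
    unfolding F_def[abs_def] W_def
    by (rule DERIV_subset[OF pairing_has_derivative[OF dv sub[OF that] L2\<psi>] subset])
  have cF: "continuous_on {1..T\<^sub>1} F" by (rule DERIV_continuous_on[OF dF])
  have cW: "continuous_on {1..T\<^sub>1} W"
    unfolding W_def[abs_def] by (rule continuous_on_subset[OF pairing_continuous[OF cv L2\<psi>] subset])
  have cQ: "continuous_on {1..T\<^sub>1} Q"
    unfolding Q_def[abs_def] by (rule continuous_on_forcing[OF k(2) p cW])
  have gradF: "(LINT x|lborel. wgrad (u s) x \<bullet> grad_x \<Phi> x s) = - F s" if s: "s \<in> {1..T\<^sub>1}" for s
  proof -
    have "(LINT x|lborel. u s x * (\<Sum>b\<in>Basis. frechet_derivative (\<lambda>y. frechet_derivative \<psi> (at y) b) (at x) b)) = F s"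
      unfolding F_def
    proof (rule integral_cong_AE)
      show "AE x in lborel. u s x * (\<Sum>b\<in>Basis. frechet_derivative (\<lambda>y. frechet_derivative \<psi> (at y) b) (at x) b) = u s x * \<psi> x"
        using outside[OF s]
      proof eventually_elim
        case (elim x)
        show ?case
        proof (cases "norm x < r")
          case True
          then show ?thesis by (simp only: lap)
        next
          case False
          have "\<phi>k k s + R < norm x" using False \<phi>_mono[of s T\<^sub>1] s by (simp add: r_def)
          then have "u s x = 0" using elim by blast
          then show ?thesis by (simp only: mult_zero_left)
        qed
      qed
      have "(\<lambda>x. frechet_derivative (\<lambda>y. frechet_derivative \<psi> (at y) b) (at x) b) \<in> borel_measurable lborel"
        if "b \<in> Basis" for b
        using test_function_L2[OF test_function_derivative[OF test_function_derivative[OF \<psi> that] that]]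
        by (rule L2_measurable)
      then show "(\<lambda>x. u s x * (\<Sum>b\<in>Basis. frechet_derivative (\<lambda>y. frechet_derivative \<psi> (at y) b) (at x) b))
          \<in> borel_measurable lborel"
        by (rule borel_measurable_times[OF L2_measurable[OF L2u[OF sub[OF s]]] borel_measurable_sum])
      show "(\<lambda>x. u s x * \<psi> x) \<in> borel_measurable lborel"
        by (rule borel_measurable_times[OF L2_measurable[OF L2u[OF sub[OF s]]] L2_measurable[OF L2\<psi>]])
    qed
    then show ?thesis
      using weak_laplacian[OF H1u[OF sub[OF s]] \<psi>] by (simp only: grad\<Phi>[OF s])
  qed
  have Pint: "set_integrable lborel {1..T\<^sub>1} P"
    and slice: "AE s in lborel. s \<in> {1..T\<^sub>1} \<longrightarrow> integrable lborel (\<lambda>x. \<bar>v s x\<bar> powr p * \<psi> x)"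
  proof -
    have "set_integrable lborel (UNIV \<times> {1..T\<^sub>1}) (\<lambda>(x, s). \<bar>v s x\<bar> powr p * \<Phi> (x, s))"
      by (rule conjunct1[OF weak[OF \<Phi>]]) (use T in simp)
    then have "set_integrable lborel (UNIV \<times> {1..T\<^sub>1}) (\<lambda>(x, s). \<bar>v s x\<bar> powr p * \<psi> x)"
      by (rule set_integrable_cong[THEN iffD1, rotated -1]) (auto simp: \<Phi>\<psi>)
    from slice_integrable[OF this] show "set_integrable lborel {1..T\<^sub>1} P"
      "AE s in lborel. s \<in> {1..T\<^sub>1} \<longrightarrow> integrable lborel (\<lambda>x. \<bar>v s x\<bar> powr p * \<psi> x)"
      by (simp_all add: P_def[abs_def])
  qed
  have identity: "W t = \<epsilon> * (LINT x|lborel. g x * \<psi> x)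
      + integral {1..t} (\<lambda>s. s powr (- 2 * k) * F s - \<mu> / s * W s) + (LINT s:{1..t}|lborel. P s)"
    if t: "t \<in> {1..T\<^sub>1}" for t
  proof -
    have ts: "s \<in> {1..T\<^sub>1}" if "s \<in> {1..t}" for s using that t by auto
    have c1: "continuous_on {1..t} F" and c2: "continuous_on {1..t} W"
      using cF cW t by (auto intro: continuous_on_subset)
    have ci: "continuous_on {1..t} (\<lambda>s. s powr (- 2 * k) * F s)" "continuous_on {1..t} (\<lambda>s. \<mu> / s * W s)"
      by (auto intro!: continuous_intros c1 c2)
    have 1: "(LINT x|lborel. v t x * \<Phi> (x, t)) = W t" "(LINT x|lborel. g x * \<Phi> (x, 1)) = (LINT x|lborel. g x * \<psi> x)"
      using t T by (simp_all add: \<Phi>\<psi> W_def)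
    have 2: "(LINT s:{1..t}|lborel. LINT x|lborel. v s x * dt \<Phi> x s) = (LINT s:{1..t}|lborel. 0)"
      by (rule set_lebesgue_integral_cong) (auto simp: dt\<Phi>[OF ts])
    have 3: "(LINT s:{1..t}|lborel. s powr (- 2 * k) * (LINT x|lborel. wgrad (u s) x \<bullet> grad_x \<Phi> x s))
        = (LINT s:{1..t}|lborel. - (s powr (- 2 * k) * F s))"
      by (rule set_lebesgue_integral_cong) (use gradF ts in auto)
    have 4: "(LINT s:{1..t}|lborel. LINT x|lborel. \<mu> / s * v s x * \<Phi> (x, s)) = (LINT s:{1..t}|lborel. \<mu> / s * W s)"
      by (rule set_lebesgue_integral_cong) (use \<Phi>\<psi> ts in \<open>auto simp: W_def mult.assoc\<close>)
    have 5: "(LINT s:{1..t}|lborel. LINT x|lborel. \<bar>v s x\<bar> powr p * \<Phi> (x, s)) = (LINT s:{1..t}|lborel. P s)"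
      by (rule set_lebesgue_integral_cong) (use \<Phi>\<psi> ts in \<open>auto simp: P_def\<close>)
    have 6: "(LINT s:{1..t}|lborel. - (s powr (- 2 * k) * F s)) = - integral {1..t} (\<lambda>s. s powr (- 2 * k) * F s)"
      "(LINT s:{1..t}|lborel. \<mu> / s * W s) = integral {1..t} (\<lambda>s. \<mu> / s * W s)"
      using ci by (simp_all add: set_integral_continuous_Icc continuous_on_minus)
    have 7: "integral {1..t} (\<lambda>s. s powr (- 2 * k) * F s - \<mu> / s * W s)
        = integral {1..t} (\<lambda>s. s powr (- 2 * k) * F s) - integral {1..t} (\<lambda>s. \<mu> / s * W s)"
      by (intro Henstock_Kurzweil_Integration.integral_diff integrable_continuous_real ci)
    have 8: "(LINT s:{1..t}|lborel. 0::real) = 0" by (simp add: set_lebesgue_integral_def)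
    show ?thesis
      using weak[OF \<Phi> sub[OF t]] unfolding 1 2 3 4 5 6 7 8 by linarith
  qed
  (* Jensen on almost every time slice: the nonlinear term has a finite
     integral only for almost every s *)
  have PQ: "AE s in lborel. s \<in> {1..T\<^sub>1} \<longrightarrow> Q s \<le> P s"
    using slice
  proof eventually_elim
    case (elim s)
    show ?case
    proof
      assume s: "s \<in> {1..T\<^sub>1}"
      then have s1: "1 \<le> s" by simp
      define w where "w x = indicator (cball 0 (\<phi>k k s + R)) x * exp (x \<bullet> e)" for x
      have le_r: "\<phi>k k s + R \<le> r" using \<phi>_mono[of s T\<^sub>1] s by (simp add: r_def)
      have intw: "integrable lborel w"
        unfolding w_def[abs_def]
        using borel_integrable_compact[OF compact_cball[of "0::'a" "\<phi>k k s + R"]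
            continuous_on_exp[OF continuous_on_inner[OF continuous_on_id continuous_on_const]], of e]
        by simp
      have eq: "AE x in lborel. v s x * \<psi> x = v s x * w x \<and> \<bar>v s x\<bar> powr p * \<psi> x = \<bar>v s x\<bar> powr p * w x"
        using outside[OF s]
      proof eventually_elim
        case (elim x)
        then show ?case using \<psi>e[of x] le_r by (cases "norm x \<le> \<phi>k k s + R") (auto simp: w_def)
      qed
      note meas = L2_measurable[OF L2v[OF sub[OF s]]] L2_measurable[OF L2\<psi>] borel_measurable_integrable[OF intw]
      have eq1: "AE x in lborel. v s x * \<psi> x = v s x * w x"
        and eq2: "AE x in lborel. \<bar>v s x\<bar> powr p * \<psi> x = \<bar>v s x\<bar> powr p * w x"
        using eq by (auto elim!: eventually_mono)
      have m1: "(\<lambda>x. v s x * \<psi> x) \<in> borel_measurable lborel" "(\<lambda>x. v s x * w x) \<in> borel_measurable lborel"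
        "(\<lambda>x. \<bar>v s x\<bar> powr p * \<psi> x) \<in> borel_measurable lborel" "(\<lambda>x. \<bar>v s x\<bar> powr p * w x) \<in> borel_measurable lborel"
        using meas by measurable
      have int1: "integrable lborel (\<lambda>x. v s x * w x)"
        using L2_mult_integrable[OF L2v[OF sub[OF s]] L2\<psi>] integrable_cong_AE[OF m1(1,2) eq1] by simp
      have int2: "integrable lborel (\<lambda>x. \<bar>v s x\<bar> powr p * w x)"
        using elim s integrable_cong_AE[OF m1(3,4) eq2] by simp
      have "(LINT x|lborel. w x) \<le> C * s powr a * exp (\<phi>k k s)"
        using C(2)[OF s1] by (simp add: w_def set_lebesgue_integral_def)
      then have "(C * s powr a * exp (\<phi>k k s)) powr (1 - p) * \<bar>LINT x|lborel. v s x * w x\<bar> powr p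
          \<le> (LINT x|lborel. \<bar>v s x\<bar> powr p * w x)"
        using C(1) s1 by (intro Jensen_weighted_power p intw int1 int2) (auto simp: w_def)
      moreover have "(LINT x|lborel. v s x * w x) = W s" "(LINT x|lborel. \<bar>v s x\<bar> powr p * w x) = P s"
        unfolding W_def P_def using integral_cong_AE[OF m1(1,2) eq1] integral_cong_AE[OF m1(3,4) eq2] by simp_all
      moreover have "(C * s powr a * exp (\<phi>k k s)) powr (1 - p)
          = C powr (1 - p) * s powr (- (a * (p - 1))) * exp (- ((p - 1) * \<phi>k k s))"
        using C(1) s1 by (simp add: powr_mult powr_powr exp_powr_real algebra_simps)
      ultimately show "Q s \<le> P s" by (simp add: Q_def)
    qed
  qed
  define M where "M t = (LINT s:{1..t}|lborel. P s - Q s)" for t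
  have Qint: "set_integrable lborel {1..T\<^sub>1} Q" by (rule borel_integrable_atLeastAtMost'[OF cQ])
  have PQint: "set_integrable lborel {1..t} (\<lambda>s. P s - Q s)" if "t \<in> {1..T\<^sub>1}" for t
    by (rule set_integrable_subset[OF set_integral_diff(1)[OF Pint Qint]]) (use that in auto)
  have M_mono: "mono_on {1..T\<^sub>1} M"
  proof (rule mono_onI)
    fix s t assume st: "s \<in> {1..T\<^sub>1}" "t \<in> {1..T\<^sub>1}" "s \<le> t"
    show "M s \<le> M t"
      unfolding M_def set_lebesgue_integral_def
    proof (rule integral_mono_AE)
      show "AE x in lborel. indicat_real {1..s} x *\<^sub>R (P x - Q x) \<le> indicat_real {1..t} x *\<^sub>R (P x - Q x)"
        using PQ by eventually_elim (use st in \<open>auto simp: indicator_def\<close>)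
    qed (use PQint[OF st(1)] PQint[OF st(2)] in \<open>simp_all add: set_integrable_def\<close>)
  qed
  have at1: "(LINT s:{1..1}|lborel. h s) = 0" for h :: "real \<Rightarrow> real"
  proof -
    have "AE s in lborel. indicat_real {1..1} s *\<^sub>R h s = 0"
      using AE_lborel_singleton[of "1::real"] by eventually_elim (auto simp: indicator_def)
    then show ?thesis unfolding set_lebesgue_integral_def by (rule integral_eq_zero_AE)
  qed
  have W1: "W 1 = \<epsilon> * (LINT x|lborel. g x * \<psi> x)"
    using identity[of 1] at1[of P] T by simp
  have eq: "W t = W 1 + integral {1..t} (\<lambda>s. s powr (- 2 * k) * F s - \<mu> / s * W s + Q s) + M t"
    if t: "t \<in> {1..T\<^sub>1}" for t
  proof -
    have c1: "continuous_on {1..t} F" "continuous_on {1..t} W" and c2: "continuous_on {1..t} Q"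
      using cF cW cQ t by (auto intro: continuous_on_subset)
    have "integral {1..t} (\<lambda>s. (s powr (- 2 * k) * F s - \<mu> / s * W s) + Q s)
        = integral {1..t} (\<lambda>s. s powr (- 2 * k) * F s - \<mu> / s * W s) + integral {1..t} Q"
      by (intro Henstock_Kurzweil_Integration.integral_add integrable_continuous_real continuous_intros c1 c2) auto
    moreover have "M t = (LINT s:{1..t}|lborel. P s) - integral {1..t} Q"
      unfolding M_def set_integral_continuous_Icc[OF c2, symmetric]
      by (intro set_integral_diff(2) set_integrable_subset[OF Pint] set_integrable_subset[OF Qint])
        (use t in auto)
    ultimately show ?thesis using identity[OF t] W1 by simp
  qed
  have "averaged_system k \<mu> p a (C powr (1 - p)) T\<^sub>1 F W"
    unfolding averaged_system_def
  proof (intro conjI ballI exI[of _ M])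
    show "M 1 = 0" unfolding M_def by (rule at1)
  qed (fact cW dF M_mono eq[unfolded Q_def])+
  moreover have inside: "(LINT x|lborel. h x * \<psi> x) = (LINT x|lborel. h x * exp (x \<bullet> e))"
    if h: "L2 h" "ess_support h \<subseteq> ball 0 R" for h
  proof (rule integral_cong_AE)
    show "AE x in lborel. h x * \<psi> x = h x * exp (x \<bullet> e)"
      using ess_support_AE[OF h(2)] 
    proof eventually_elim
      case (elim x)
      show ?case
      proof (cases "norm x < R")
        case True
        then show ?thesis using \<psi>e[of x] r by simp
      next
        case False
        then show ?thesis using elim by simp
      qed
    qed
    show "(\<lambda>x. h x * \<psi> x) \<in> borel_measurable lborel" "(\<lambda>x. h x * exp (x \<bullet> e)) \<in> borel_measurable lborel"
      using L2_measurable[OF h(1)] L2_measurable[OF L2\<psi>] by measurable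
  qed
  moreover have "F 1 = \<epsilon> * (LINT x|lborel. f x * \<psi> x)"
  proof -
    have "F 1 = (LINT x|lborel. \<epsilon> * (f x * \<psi> x))"
      unfolding F_def
    proof (rule integral_cong_AE)
      show "AE x in lborel. u 1 x * \<psi> x = \<epsilon> * (f x * \<psi> x)"
        using u1 by eventually_elim simp
      show "(\<lambda>x. u 1 x * \<psi> x) \<in> borel_measurable lborel" "(\<lambda>x. \<epsilon> * (f x * \<psi> x)) \<in> borel_measurable lborel"
        using L2_measurable[OF L2u[OF sub[of 1]]] L2_measurable[OF f(1)] L2_measurable[OF L2\<psi>] T
        by (simp_all add: borel_measurable_times)
    qed
    then show ?thesis by simp
  qed
  ultimately show thesis
    using that[of F W] unfolding W1 inside[OF f] inside[OF g] by blast
qed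

section \<open>The lifespan estimate\<close>

text \<open>Both initial averages must be strictly positive: \<open>F 1\<close> and \<open>W 1\<close> start the growth of the averaged
  system.\<close>

lemma exponential_moment_pos:
  fixes h :: "'a::euclidean_space \<Rightarrow> real"
  assumes e: "e \<in> Basis" and R: "0 < R" and h: "L2 h" "ess_support h \<subseteq> ball 0 R"
    and nonneg: "AE x in lborel. 0 \<le> h x" and nz: "\<not> (AE x in lborel. h x = 0)"
  shows "0 < (LINT x|lborel. h x * exp (x \<bullet> e))"
proof -
  obtain \<psi> where \<psi>: "test_function UNIV \<psi>" and \<psi>e: "\<And>x. norm x \<le> R \<Longrightarrow> \<psi> x = exp (x \<bullet> e)"
    by (rule truncated_exponential[OF e R]) (blast intro: that)
  have eq: "AE x in lborel. h x * \<psi> x = h x * exp (x \<bullet> e)"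
    using ess_support_AE[OF h(2)]
  proof eventually_elim
    case (elim x)
    show ?case
    proof (cases "norm x < R")
      case True
      then show ?thesis by (simp only: \<psi>e less_imp_le)
    next
      case False
      then have "h x = 0" using elim by simp
      then show ?thesis by (simp only: mult_zero_left)
    qed
  qed
  have m: "(\<lambda>x. h x * \<psi> x) \<in> borel_measurable lborel" "(\<lambda>x. h x * exp (x \<bullet> e)) \<in> borel_measurable lborel"
    using L2_measurable[OF h(1)] L2_measurable[OF test_function_L2[OF \<psi>]] by simp_all
  have int: "integrable lborel (\<lambda>x. h x * exp (x \<bullet> e))"
    by (rule integrable_cong_AE[THEN iffD1, OF m eq L2_mult_integrable[OF h(1) test_function_L2[OF \<psi>]]])
  have ge: "AE x in lborel. 0 \<le> h x * exp (x \<bullet> e)"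
    using nonneg by eventually_elim simp
  have "(LINT x|lborel. h x * exp (x \<bullet> e)) \<noteq> 0"
    unfolding integral_nonneg_eq_0_iff_AE[OF int ge] mult_eq_0_iff using nz by (simp only: exp_not_eq_zero simp_thms)
  moreover have "0 \<le> (LINT x|lborel. h x * exp (x \<bullet> e))"
    by (rule integral_nonneg_AE[OF ge])
  ultimately show ?thesis by linarith
qed

lemma energy_solution_time_bound:
  fixes f g :: "'a::euclidean_space \<Rightarrow> real" and k \<mu> R p :: real
  assumes k: "0 \<le> k" "k < 1" and \<mu>: "0 < \<mu>" and R: "0 < R" and p: "1 < p"
    and f: "L2 f" "ess_support f \<subseteq> ball 0 R" "AE x in lborel. 0 \<le> f x" "\<not> (AE x in lborel. f x = 0)"
    and g: "L2 g" "ess_support g \<subseteq> ball 0 R" "AE x in lborel. 0 \<le> g x" "\<not> (AE x in lborel. g x = 0)"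
  obtains B where "0 < B" and
    "\<And>\<epsilon> T u T\<^sub>1. \<lbrakk>0 < \<epsilon>; energy_solution k \<mu> p f g \<epsilon> T u;
      curve_support T u \<subseteq> {(x, t). 1 \<le> t \<and> norm x \<le> \<phi>k k t + R}; 1 \<le> T\<^sub>1; T\<^sub>1 < T\<rbrakk> \<Longrightarrow>
      integral {1..T\<^sub>1} (\<lambda>t. t powr (- (((1 - k) * (real DIM('a) - 1) + k + \<mu>) * (p - 1) / 2)))
        \<le> B * \<epsilon> powr (- (p - 1))"
proof -
  obtain e :: 'a where e: "e \<in> Basis" using nonempty_Basis by blast
  define a where "a = (1 - k) * (real DIM('a) - 1) / 2"
  obtain C where C: "0 < C" "\<And>t. 1 \<le> t \<Longrightarrow>
      (LINT x:cball 0 (\<phi>k k t + R)|lborel. exp (x \<bullet> e)) \<le> C * t powr a * exp (\<phi>k k t)"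
    unfolding a_def using exponential_cone_integral[OF e k R] by blast
  have c: "0 < C powr (1 - p)" using C(1) by simp
  obtain B where B: "0 < B" and bound: "\<And>\<epsilon> T F W. \<lbrakk>0 < \<epsilon>; 1 \<le> T;
      averaged_system k \<mu> p a (C powr (1 - p)) T F W;
      F 1 = \<epsilon> * (LINT x|lborel. f x * exp (x \<bullet> e)); W 1 = \<epsilon> * (LINT x|lborel. g x * exp (x \<bullet> e))\<rbrakk>
      \<Longrightarrow> integral {1..T} (\<lambda>t. t powr (- ((a + (k + \<mu>) / 2) * (p - 1)))) \<le> B * \<epsilon> powr (- (p - 1))"
    using blow_up_time_bound[OF k \<mu> p c exponential_moment_pos[OF e R f] exponential_moment_pos[OF e R g], of a]
    by blast
  have \<Lambda>: "(a + (k + \<mu>) / 2) * (p - 1) = ((1 - k) * (real DIM('a) - 1) + k + \<mu>) * (p - 1) / 2"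
    by (simp add: a_def field_simps)
  show thesis
  proof (rule that[OF B])
    fix \<epsilon> T u T\<^sub>1
    assume \<epsilon>: "0 < \<epsilon>" and sol: "energy_solution k \<mu> p f g \<epsilon> T u"
      and supp: "curve_support T u \<subseteq> {(x, t). 1 \<le> t \<and> norm x \<le> \<phi>k k t + R}"
      and T: "1 \<le> T\<^sub>1" "T\<^sub>1 < T"
    obtain F W where "averaged_system k \<mu> p a (C powr (1 - p)) T\<^sub>1 F W"
      "F 1 = \<epsilon> * (LINT x|lborel. f x * exp (x \<bullet> e))" "W 1 = \<epsilon> * (LINT x|lborel. g x * exp (x \<bullet> e))"
      using energy_solution_averaged[OF e k p R C f(1,2) g(1,2) sol supp T] by blast
    from bound[OF \<epsilon> T(1) this]
    show "integral {1..T\<^sub>1} (\<lambda>t. t powr (- (((1 - k) * (real DIM('a) - 1) + k + \<mu>) * (p - 1) / 2)))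
        \<le> B * \<epsilon> powr (- (p - 1))"
      unfolding \<Lambda> .
  qed
qed

text \<open>A bound on every time strictly before \<open>T\<close> is a bound on \<open>T\<close>; solutions can only be tested on
  \<open>[1, T\<^sub>1]\<close> with \<open>T\<^sub>1 < T\<close>.\<close>

lemma lifespan_le:
  assumes "\<And>T u T\<^sub>1. energy_solution k \<mu> p f g \<epsilon> T u \<Longrightarrow>
      curve_support T u \<subseteq> {(x, t). 1 \<le> t \<and> norm x \<le> \<phi>k k t + R} \<Longrightarrow> 1 \<le> T\<^sub>1 \<Longrightarrow> T\<^sub>1 < T \<Longrightarrow> T\<^sub>1 \<le> b"
  shows "lifespan k \<mu> R p f g \<epsilon> \<le> ereal b"
  unfolding lifespan_def
proof (rule Sup_least, safe)
  fix T u
  assume T: "1 < T" and sol: "energy_solution k \<mu> p f g \<epsilon> T u"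
    "curve_support T u \<subseteq> {(x, t). 1 \<le> t \<and> norm x \<le> \<phi>k k t + R}"
  have "T \<le> b"
    by (rule dense_le_bounded[OF T]) (use assms[OF sol] in auto)
  then show "ereal T \<le> ereal b" by simp
qed

theorem theorem2p2:
  fixes f g :: "real ^ 'n::finite \<Rightarrow> real" and k \<mu> R p :: real
  assumes "0 \<le> k" and "k < 1" and "0 < \<mu>" and "0 < R"
    and "1 < p" and "p \<le> p_E CARD('n) k \<mu>"
    and "H1 f" and "L2 g"
    and "AE x in lborel. 0 \<le> f x" and "AE x in lborel. 0 \<le> g x"
    and "compact (ess_support f)" and "ess_support f \<subseteq> ball 0 R"
    and "compact (ess_support g)" and "ess_support g \<subseteq> ball 0 R"
    and "\<not> (AE x in lborel. f x = 0)" and "\<not> (AE x in lborel. g x = 0)"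
  shows "\<exists>\<epsilon>\<^sub>0>0. \<exists>C>0. \<forall>\<epsilon>. 0 < \<epsilon> \<and> \<epsilon> \<le> \<epsilon>\<^sub>0 \<longrightarrow>
    lifespan k \<mu> R p f g \<epsilon> < \<infinity> \<and>
    (p < p_E CARD('n) k \<mu> \<longrightarrow>
       lifespan k \<mu> R p f g \<epsilon> \<le> ereal (C * \<epsilon> powr
         (- (2 * (p - 1) / (2 - ((1 - k) * (real CARD('n) - 1) + k + \<mu>) * (p - 1)))))) \<and>
    (p = p_E CARD('n) k \<mu> \<longrightarrow>
       lifespan k \<mu> R p f g \<epsilon> \<le> ereal (exp (C * \<epsilon> powr (- (p - 1)))))"
proof -
  define E where "E = (1 - k) * (real CARD('n) - 1) + k + \<mu>"
  (* the decay exponent of the averaged inequality; p \<le> p_E means \<Lambda> \<le> 1 *)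
  define \<Lambda> where "\<Lambda> = E * (p - 1) / 2"
  have "1 \<le> CARD('n)" by (simp add: Suc_leI)
  then have "0 \<le> (1 - k) * (real CARD('n) - 1)" using assms(2) by simp
  then have E: "0 < E" using assms(1,3) by (simp add: E_def)
  have pE: "p_E CARD('n) k \<mu> = 1 + 2 / E" by (simp add: p_E_def E_def)
  have Lf: "L2 f" using assms(7) by (simp add: H1_def)
  obtain B where B: "0 < B" and bound: "\<And>\<epsilon> T u T\<^sub>1. \<lbrakk>0 < \<epsilon>; energy_solution k \<mu> p f g \<epsilon> T u;
      curve_support T u \<subseteq> {(x, t). 1 \<le> t \<and> norm x \<le> \<phi>k k t + R}; 1 \<le> T\<^sub>1; T\<^sub>1 < T\<rbrakk> \<Longrightarrow>
      integral {1..T\<^sub>1} (\<lambda>t. t powr (- \<Lambda>)) \<le> B * \<epsilon> powr (- (p - 1))"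
    using energy_solution_time_bound[OF assms(1-5) Lf assms(12,9,15,8,14,10,16)]
    unfolding \<Lambda>_def E_def by (auto simp: DIM_cart)
  show ?thesis
  proof (cases "p < p_E CARD('n) k \<mu>")
    case True
    then have \<Lambda>: "\<Lambda> < 1" using E by (simp add: pE \<Lambda>_def field_simps)
    define C where "C = (1 + (1 - \<Lambda>) * B) powr (1 / (1 - \<Lambda>))"
    have "0 < 1 + (1 - \<Lambda>) * B" using \<Lambda> B by (simp add: add_pos_pos)
    then have C: "0 < C" by (simp add: C_def)
    have expo: "(p - 1) / (1 - \<Lambda>) = 2 * (p - 1) / (2 - E * (p - 1))"
      using \<Lambda> by (simp add: \<Lambda>_def field_simps)
    have life: "lifespan k \<mu> R p f g \<epsilon> \<le> ereal (C * \<epsilon> powr (- (2 * (p - 1) / (2 - E * (p - 1)))))"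
      if "0 < \<epsilon>" "\<epsilon> \<le> 1" for \<epsilon>
      using subcritical_integral_bound[OF \<Lambda> B assms(5) that _ bound[OF that(1)]]
      unfolding C_def expo by (intro lifespan_le)
    have "lifespan k \<mu> R p f g \<epsilon> < \<infinity>" if "0 < \<epsilon>" "\<epsilon> \<le> 1" for \<epsilon>
      by (rule le_less_trans[OF life[OF that]]) simp
    then show ?thesis
      using C True life unfolding E_def by (intro exI[of _ 1] conjI exI[of _ C]) auto
  next
    case False
    then have crit: "p = p_E CARD('n) k \<mu>" using assms(6) by simp
    then have "\<Lambda> = 1" using E by (simp add: pE \<Lambda>_def)
    then have life: "lifespan k \<mu> R p f g \<epsilon> \<le> ereal (exp (B * \<epsilon> powr (- (p - 1))))" if "0 < \<epsilon>" for \<epsilon>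
      using critical_integral_bound bound[OF that] by (intro lifespan_le) blast
    have "lifespan k \<mu> R p f g \<epsilon> < \<infinity>" if "0 < \<epsilon>" for \<epsilon>
      by (rule le_less_trans[OF life[OF that]]) simp
    then show ?thesis
      using B False life by (intro exI[of _ 1] conjI exI[of _ B]) auto
  qed
qed

end
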